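(* Let $P$ be a triangular polyhedron with $f$ faces $F_1,\dots,F_f$, inscribed in the unit sphere of $\mathbb{R}^3$ centred at the origin $O$ and star-shaped with respect to $O$. For each $i$ let $c_i$ be the arc-length (spherical length) of the edge of $F_i$ corresponding to the maximal central angle of $F_i$, and let $\tau_i$ be the spherical area of the spherical triangle corresponding to $F_i$. Let $\varphi$ be the function described in the context. Assume that $0<\tau_i<\pi/2$ for all $i$. Assume further that for $i=1,\dots,f'$ we have $0<\tau_i\le c_i\le \min\{\varphi(\tau_i),\,2\sin^{-1}\sqrt{2/3}\}$, and that for all $j>f'$ we have $0<\varphi(\tau_j)\le c_j\le 2\sin^{-1}\sqrt{2/3}$. Put $c':=\frac{1}{f'}\sum_{i=1}^{f'}c_i$ and $c^\star:=\frac{1}{f-f'}\sum_{i=f'+1}^{f}\varphi(\tau_i)$. Then the volume $v(P)$ of $P$ satisfies $$ v(P)\le \frac{f}{6}\,\sin\left(\frac{f'c'+(f-f')c^\star}{f}\right)\,\frac{\cos\left(\frac{4\pi-f'c'-(f-f')c^\star}{2f}\right)-\cos\frac{2\pi}{f}\cos\left(\frac{f'c'+(f-f')c^\star}{2f}\right)}{1-\cos\frac{2\pi}{f}\cos\left(\frac{f'c'+(f-f')c^\star}{2f}\right)} . $$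
   Context: "Inscribed in the unit sphere" means that all vertices of the polyhedron lie on the unit sphere; "triangular" means that all faces are triangles. Since $P$ is star-shaped with respect to $O$, the central projections from $O$ of the faces $F_i$ onto the unit sphere are spherical triangles tiling the sphere; the spherical triangle corresponding to $F_i$ is this projection (it has the same three vertices as $F_i$). The central angle corresponding to an edge of a face $ABC$ is the angle of the rectilinear (Euclidean) triangle $ABC$ opposite to that edge (e.g. the central angle of $AB$ is the angle at $C$). The function $\varphi$: put $$ v(\tau,c):=\frac{1}{6}\sin c\;\frac{\cos\frac{\tau-c}{2}-\cos\frac{\tau}{2}\cos\frac{c}{2}}{1-\cos\frac{c}{2}\cos\frac{\tau}{2}} . $$ The function $\varphi$ is the concave function of $\tau$ whose graph $c=\varphi(\tau)$ is given by the zeros of the Hessian determinant $v_{\tau\tau}v_{cc}-v_{\tau c}^2$, and which separates the region $$\mathcal{D}=\{(\tau,c): 0<\tau<\pi/2,\ \tau\le c<\min\{\varphi(\tau),2\sin^{-1}\sqrt{2/3}\}\},$$ on which $v(\tau,c)$ is concave, from the region $$\mathcal{D}'=\{(\tau,c): 0<\tau\le\omega,\ \varphi(\tau)\le c\le 2\sin^{-1}\sqrt{2/3}\},$$ on which $v$ is not concave; here $\omega$ is the value with $\varphi(\omega)=2\sin^{-1}\sqrt{2/3}$ ($\omega\approx 0.697715$), and for $\tau>\omega$ the minimum $\min\{\varphi(\tau),2\sin^{-1}\sqrt{2/3}\}$ equals $2\sin^{-1}\sqrt{2/3}$. If $f'=0$ (respectively $f'=f$), the product $f'c'$ (respectively $(f-f')c^\star$)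 is read as $0$. *)

theory Defs
  imports "HOL-Analysis.Analysis"
begin

definition vangle :: "'a::real_inner \<Rightarrow> 'a \<Rightarrow> real" where
  "vangle x y = arccos (x \<bullet> y / (norm x * norm y))"

definition star_shaped_wrt :: "'a::real_vector \<Rightarrow> 'a set \<Rightarrow> bool" where
  "star_shaped_wrt a S \<longleftrightarrow> a \<in> S \<and> (\<forall>x\<in>S. closed_segment a x \<subseteq> S)"

text \<open>
  A solid polyhedron \<open>P\<close>, not necessarily convex, whose boundary is the union of the \<open>f\<close>
  pairwise distinct nondegenerate triangles \<open>F 1, \<dots>, F f\<close>, any two of which meet in a common
  (possibly empty) face; the last condition is part of \<^const>\<open>triangulation\<close>.
  The vertices of \<open>P\<close> are the extreme points of the triangles.
\<close>

definition triangular_polyhedron ::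
    "(real ^ 3) set \<Rightarrow> nat \<Rightarrow> (nat \<Rightarrow> (real ^ 3) set) \<Rightarrow> bool" where
  "triangular_polyhedron P f F \<longleftrightarrow>
     P \<noteq> {} \<and> compact P \<and> closure (interior P) = P \<and>
     inj_on F {1..f} \<and> (\<forall>i\<in>{1..f}. 2 simplex F i) \<and> triangulation (F ` {1..f}) \<and>
     frontier P = (\<Union>i\<in>{1..f}. F i)"

definition inscribed_in_unit_sphere :: "nat \<Rightarrow> (nat \<Rightarrow> (real ^ 3) set) \<Rightarrow> bool" where
  "inscribed_in_unit_sphere f F \<longleftrightarrow> (\<forall>i\<in>{1..f}. {x. x extreme_point_of F i} \<subseteq> sphere 0 1)"

definition central_projection :: "(real ^ 3) set \<Rightarrow> (real ^ 3) set" where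
  "central_projection S = (\<lambda>x. x /\<^sub>R norm x) ` (S - {0})"

text \<open>
  The surface measure on the unit sphere: the area of \<open>A\<close> is three times the volume of the
  cone over \<open>A\<close> with apex at the centre. The whole sphere has area \<open>3 * (4 / 3 * pi) = 4 * pi\<close>.
\<close>

definition spherical_area :: "(real ^ 3) set \<Rightarrow> real" where
  "spherical_area A = 3 * measure lebesgue {t *\<^sub>R x | t x. 0 \<le> t \<and> t \<le> 1 \<and> x \<in> A}"

text \<open>
  \<open>c\<close> is the spherical length of an edge \<open>AB\<close> of the triangle \<open>T = ABC\<close> (with vertices on the
  unit sphere) for which the opposite Euclidean angle, at \<open>C\<close>, is maximal.
\<close>

definition max_central_angle_edge_length :: "(real ^ 3) set \<Rightarrow> real \<Rightarrow> bool" where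
  "max_central_angle_edge_length T c \<longleftrightarrow>
     (\<exists>A B C. {x. x extreme_point_of T} = {A, B, C} \<and>
        vangle (B - A) (C - A) \<le> vangle (A - C) (B - C) \<and>
        vangle (A - B) (C - B) \<le> vangle (A - C) (B - C) \<and>
        c = vangle A B)"

definition vol :: "real \<Rightarrow> real \<Rightarrow> real" where
  "vol \<tau> c = 1 / 6 * sin c *
     ((cos ((\<tau> - c) / 2) - cos (\<tau> / 2) * cos (c / 2)) / (1 - cos (c / 2) * cos (\<tau> / 2)))"

definition hessian_det :: "(real \<Rightarrow> real \<Rightarrow> real) \<Rightarrow> real \<Rightarrow> real \<Rightarrow> real" where
  "hessian_det g x y =
     (deriv ^^ 2) (\<lambda>s. g s y) x * (deriv ^^ 2) (\<lambda>t. g x t) y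
     - (deriv (\<lambda>t. deriv (\<lambda>s. g s t) x) y)\<^sup>2"

definition c_max :: real where
  "c_max = 2 * arcsin (sqrt (2 / 3))"

definition region_D :: "(real \<Rightarrow> real) \<Rightarrow> (real \<times> real) set" where
  "region_D \<phi> = {(\<tau>, c). 0 < \<tau> \<and> \<tau> < pi / 2 \<and> \<tau> \<le> c \<and> c < min (\<phi> \<tau>) c_max}"

definition region_D' :: "(real \<Rightarrow> real) \<Rightarrow> real \<Rightarrow> (real \<times> real) set" where
  "region_D' \<phi> \<omega> = {(\<tau>, c). 0 < \<tau> \<and> \<tau> \<le> \<omega> \<and> \<phi> \<tau> \<le> c \<and> c \<le> c_max}"

text \<open>
  The description of the function \<open>\<phi>\<close> on \<open>(0, \<pi>/2)\<close>. Numerically, for each \<open>\<tau>\<close> in this interval the Hessian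
  determinant of \<^const>\<open>vol\<close> has two zeros \<open>c\<close> in \<open>(0, \<pi>)\<close>, one below and one above the diagonal
  \<open>c = \<tau>\<close>; the condition on \<open>\<omega>\<close> selects the upper branch. Since \<^const>\<open>region_D'\<close> is not convex,
  non-concavity there is expressed locally: \<^const>\<open>vol\<close> is not concave near any point of it.
\<close>

definition separating_function :: "(real \<Rightarrow> real) \<Rightarrow> bool" where
  "separating_function \<phi> \<longleftrightarrow>
     concave_on {0<..<pi/2} \<phi> \<and>
     (\<forall>\<tau>\<in>{0<..<pi/2}. hessian_det vol \<tau> (\<phi> \<tau>) = 0) \<and>
     concave_on (region_D \<phi>) (\<lambda>(\<tau>, c). vol \<tau> c) \<and>
     (\<exists>\<omega>\<in>{0<..<pi/2}. \<phi> \<omega> = c_max \<and> (\<forall>\<tau>\<in>{\<omega><..<pi/2}. min (\<phi> \<tau>) c_max = c_max) \<and>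
        (\<forall>p\<in>region_D' \<phi> \<omega>. \<forall>e>0. \<not> concave_on (ball p e) (\<lambda>(\<tau>, c). vol \<tau> c)))"

end

theory Submission
  imports Defs
begin

text \<open>
  The bound comes from cutting \<open>P\<close> into the tetrahedra spanned by the origin and the faces.
  Because \<open>P\<close> is star-shaped, every ray from the origin leaves \<open>P\<close> through a face and never
  returns. So the cones over the faces tile space: the spherical areas \<open>\<tau> i\<close> add up to \<open>4 * pi\<close>
  (\<open>sum_spherical_area\<close>), and the volume of \<open>P\<close> is at most the sum of the volumes of the
  tetrahedra (\<open>volume_le\<close>).

  For a single face \<open>ABC\<close> let \<open>D\<close> be the triple product of its vertices, so that its
  tetrahedron has volume \<open>D / 6\<close>. Girard's theorem yields
  \<open>tan (\<tau> / 2) = D / (1 + A \<bullet> B + A \<bullet> C + B \<bullet> C)\<close> (\<open>tan_half_solid_angle\<close>). For a fixed area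
  and a fixed edge \<open>AB\<close> this confines \<open>C\<close> to a plane, which cuts the sphere in Lexell's circle.
  On that circle \<open>D\<close> is largest when the triangle is isosceles, and the largest value of \<open>D / 6\<close>
  is \<open>vol \<tau> c\<close> (\<open>triple_product_le_isosceles\<close>).

  As a function of \<open>c\<close>, \<open>vol \<tau> c\<close> increases until the isosceles triangle is regular and decreases
  afterwards. At regular triangles the Hessian of \<open>vol\<close> is negative definite
  (\<open>hessian_pos_at_stationary_edge\<close>), so \<open>vol\<close> is concave near them. Since \<open>vol\<close> is nowhere
  locally concave between the graph of \<open>\<phi>\<close> and \<open>c_max\<close>, the graph runs on the side where
  \<open>vol\<close> decreases in \<open>c\<close> (\<open>separating_function_edge_slope_nonneg\<close>). Hence replacing an edge
  length \<open>c j\<close> above \<open>\<phi> (\<tau> j)\<close> by \<open>\<phi> (\<tau> j)\<close> only increases the bound (\<open>vol_antimono_edge\<close>).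

  After this replacement all points \<open>(\<tau> i, c i)\<close> lie in the closure of the convex region on which
  \<open>vol\<close> is concave, and Jensen's inequality (\<open>sum_vol_le_vol_mean\<close>) replaces them by their mean,
  whose first coordinate is \<open>4 * pi / f\<close>.
\<close>

section \<open>Wedges of a ball\<close>

lemma measure_split_hyperplane:
  fixes n :: "'a::euclidean_space"
  assumes "S \<in> lmeasurable" "n \<noteq> 0"
  shows "measure lebesgue S =
    measure lebesgue (S \<inter> {v. 0 \<le> n \<bullet> v}) + measure lebesgue (S \<inter> {v. n \<bullet> v \<le> 0})"
proof -
  have sets: "{v. 0 \<le> n \<bullet> v} \<in> sets lebesgue" "{v. n \<bullet> v \<le> 0} \<in> sets lebesgue"
    by (auto intro!: lebesgue_closedin simp: closed_halfspace_le closed_halfspace_ge)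
  have meas: "S \<inter> {v. 0 \<le> n \<bullet> v} \<in> lmeasurable" "S \<inter> {v. n \<bullet> v \<le> 0} \<in> lmeasurable"
    using assms sets fmeasurable_Int_fmeasurable by blast+
  have neg: "negligible ((S \<inter> {v. 0 \<le> n \<bullet> v}) \<inter> (S \<inter> {v. n \<bullet> v \<le> 0}))"
    by (rule negligible_subset[OF negligible_hyperplane[of n 0]]) (use assms in auto)
  have "S = (S \<inter> {v. 0 \<le> n \<bullet> v}) \<union> (S \<inter> {v. n \<bullet> v \<le> 0})" by auto
  then have "measure lebesgue S = measure lebesgue ((S \<inter> {v. 0 \<le> n \<bullet> v}) \<union> (S \<inter> {v. n \<bullet> v \<le> 0}))"
    by simp
  also have "\<dots> = measure lebesgue (S \<inter> {v. 0 \<le> n \<bullet> v}) + measure lebesgue (S \<inter> {v. n \<bullet> v \<le> 0})"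
    using measure_Un3[OF meas] negligible_imp_measure0[OF neg] by simp
  finally show ?thesis .
qed

text \<open>
  Additivity and nonnegativity make \<open>g\<close> monotone, so \<open>g x\<close> is squeezed between the values at
  neighbouring multiples of \<open>L / n\<close>, and there additivity determines \<open>g\<close>.
\<close>

lemma additive_nonneg_imp_linear:
  fixes g :: "real \<Rightarrow> real"
  assumes L: "0 < L" and x: "0 \<le> x" "x \<le> L"
    and nn: "\<And>s. 0 \<le> s \<Longrightarrow> s \<le> L \<Longrightarrow> 0 \<le> g s"
    and add: "\<And>s t. 0 \<le> s \<Longrightarrow> 0 \<le> t \<Longrightarrow> s + t \<le> L \<Longrightarrow> g (s + t) = g s + g t"
  shows "g x = x / L * g L"
proof -
  have g0: "g 0 = 0" using add[of 0 0] L by simp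
  have mono: "g s \<le> g t" if "0 \<le> s" "s \<le> t" "t \<le> L" for s t
    using add[of s "t - s"] nn[of "t - s"] that by simp
  have mult: "g (real m * s) = real m * g s" if "0 \<le> s" "real m * s \<le> L" for m s
    using that
  proof (induction m)
    case 0 then show ?case using g0 by simp
  next
    case (Suc m)
    have "real m * s \<le> L" using Suc.prems by (simp add: algebra_simps)
    with Suc add[of "real m * s" s] show ?case by (simp add: algebra_simps)
  qed
  have bound: "\<bar>g x - x / L * g L\<bar> \<le> g L / real n" if n: "n > 0" for n :: nat
  proof -
    define s where "s = L / real n"
    define m where "m = nat \<lfloor>x / s\<rfloor>"
    have s: "s > 0" "real n * s = L" using n L by (auto simp: s_def)
    have gs: "g s = g L / real n" using mult[of s n] s n by (simp add: field_simps)
    have m: "real m \<le> x / s" "x / s < real m + 1"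
      using x s by (auto simp: m_def)
    then have m': "real m * s \<le> x" "x < real m * s + s" using s by (auto simp: field_simps)
    have gL: "g L \<ge> 0" using nn L by simp
    have gs0: "g s \<ge> 0" using gs gL by simp
    have gLn: "g L = real n * g s" using gs n by simp
    have lo: "real m * g s \<le> g x" using mono[of "real m * s" x] mult[of s m] m' x s by simp
    have hi: "g x \<le> (real m + 1) * g s"
    proof (cases "real m * s + s \<le> L")
      case True
      then show ?thesis using mono[of x "real (Suc m) * s"] mult[of s "Suc m"] m' x s
        by (simp add: algebra_simps)
    next
      case False
      then have "real n * s < (real m + 1) * s" using s by (simp add: algebra_simps)
      then have "real n < real m + 1" using s(1) mult_less_cancel_right_pos by blast
      moreover have "real m * s \<le> real n * s" using m' x s by simp
      then have "real m \<le> real n" using s(1) mult_le_cancel_right_pos by blast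
      ultimately have "m = n" by simp
      then show ?thesis using mono[of x L] x gLn gs0 by (simp add: distrib_right)
    qed
    have e: "x / L * g L = x / s * g s" using gs s n L by (simp add: s_def field_simps)
    have "real m * g s \<le> x / s * g s" "x / s * g s \<le> (real m + 1) * g s"
      using m gs0 by (blast intro: mult_right_mono less_imp_le)+
    moreover have "(real m + 1) * g s = real m * g s + g s" by (simp add: distrib_right)
    ultimately have "\<bar>g x - x / L * g L\<bar> \<le> g s" using lo hi unfolding e by linarith
    then show ?thesis using gs by simp
  qed
  have "(\<lambda>n. g L / real n) \<longlonglongrightarrow> 0"
    by (rule lim_const_over_n)
  then have "\<bar>g x - x / L * g L\<bar> \<le> 0"
    by (rule LIMSEQ_le_const) (use bound in \<open>auto intro!: exI[of _ 1]\<close>)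
  then show ?thesis by simp
qed

text \<open>
  The rotation by \<open>\<theta>\<close> in the plane of \<open>a\<close> and \<open>b\<close>, fixing the orthogonal complement. Written
  as a perturbation of the identity, it makes sense without a basis of the complement.
\<close>

lemma orthogonal_planar_rotation:
  fixes a b :: "'a::real_inner"
  assumes ab: "norm a = 1" "norm b = 1" "a \<bullet> b = 0"
  defines "R \<equiv> \<lambda>\<theta> v. v + ((cos \<theta> - 1) * (a \<bullet> v) - sin \<theta> * (b \<bullet> v)) *\<^sub>R a
                         + (sin \<theta> * (a \<bullet> v) + (cos \<theta> - 1) * (b \<bullet> v)) *\<^sub>R b"
  shows "orthogonal_transformation (R \<theta>)"
    and "a \<bullet> R \<theta> v = cos \<theta> * (a \<bullet> v) - sin \<theta> * (b \<bullet> v)"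
    and "b \<bullet> R \<theta> v = sin \<theta> * (a \<bullet> v) + cos \<theta> * (b \<bullet> v)"
proof -
  have n: "a \<bullet> a = 1" "b \<bullet> b = 1" "a \<bullet> b = 0" "b \<bullet> a = 0"
    using ab by (auto simp: norm_eq_1 inner_commute)
  show A: "a \<bullet> R \<theta> v = cos \<theta> * (a \<bullet> v) - sin \<theta> * (b \<bullet> v)" for v
    by (simp add: R_def inner_add_right n algebra_simps)
  show B: "b \<bullet> R \<theta> v = sin \<theta> * (a \<bullet> v) + cos \<theta> * (b \<bullet> v)" for v
    by (simp add: R_def inner_add_right n algebra_simps)
  have lin: "linear (R \<theta>)"
    unfolding R_def by (rule linearI) (simp_all add: inner_add_right algebra_simps)
  have "R \<theta> v \<bullet> R \<theta> v = v \<bullet> v" for v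
  proof -
    define p q where "p = a \<bullet> v" and "q = b \<bullet> v"
    have pq: "v \<bullet> a = p" "v \<bullet> b = q" by (simp_all add: p_def q_def inner_commute)
    define s c where "s = sin \<theta>" and "c = cos \<theta>"
    have sc: "s\<^sup>2 = 1 - c\<^sup>2" unfolding s_def c_def by (simp add: sin_squared_eq)
    have "R \<theta> v \<bullet> R \<theta> v = v \<bullet> v + 2 * ((c - 1) * p - s * q) * p + 2 * (s * p + (c - 1) * q) * q
       + ((c - 1) * p - s * q)\<^sup>2 + (s * p + (c - 1) * q)\<^sup>2"
      unfolding R_def s_def[symmetric] c_def[symmetric] p_def[symmetric] q_def[symmetric]
      by (simp add: inner_add_right inner_add_left n pq algebra_simps power2_eq_square
          flip: p_def q_def)
    also have "\<dots> = v \<bullet> v + (s\<^sup>2 - (1 - c\<^sup>2)) * (p\<^sup>2 + q\<^sup>2)"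
      by (simp add: power2_eq_square algebra_simps)
    finally show ?thesis using sc by simp
  qed
  then show "orthogonal_transformation (R \<theta>)"
    using lin by (simp add: orthogonal_transformation norm_eq)
qed

text \<open>
  Up to a null set, the wedge consists of the points whose projection to the plane of \<open>a\<close> and
  \<open>b\<close> has polar angle between \<open>0\<close> and \<open>\<theta>\<close>. Rotating a wedge of angle \<open>t\<close> by \<open>s\<close> and adjoining a wedge of angle \<open>s\<close>
  gives one of angle \<open>s + t\<close>, so the measure is additive in the angle and therefore linear. At
  angle \<open>pi\<close> the wedge is a half ball.
\<close>

lemma measure_ball_wedge_orthonormal:
  fixes a b :: "(real, 'n::{finite,wellorder}) vec"
  assumes ab: "norm a = 1" "norm b = 1" "a \<bullet> b = 0" and \<theta>: "0 \<le> \<theta>" "\<theta> \<le> pi"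
  shows "measure lebesgue (cball 0 1 \<inter> {v. 0 \<le> b \<bullet> v} \<inter> {v. 0 \<le> sin \<theta> * (a \<bullet> v) - cos \<theta> * (b \<bullet> v)})
         = \<theta> / (2 * pi) * measure lebesgue (cball 0 1 :: (real, 'n) vec set)"
proof -
  let ?B = "cball 0 1 :: (real, 'n) vec set"
  let ?q = "\<lambda>\<theta> v. sin \<theta> * (a \<bullet> v) - cos \<theta> * (b \<bullet> v)"
  let ?m = "measure lebesgue :: (real, 'n) vec set \<Rightarrow> real"
  define W where "W \<theta> = ?B \<inter> {v. 0 \<le> b \<bullet> v} \<inter> {v. 0 \<le> ?q \<theta> v}" for \<theta>
  have nb: "b \<noteq> 0" using ab by auto
  have q_inner: "?q \<theta> v = (sin \<theta> *\<^sub>R a - cos \<theta> *\<^sub>R b) \<bullet> v" for \<theta> v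
    by (simp add: inner_diff_left)
  have n: "a \<bullet> a = 1" "b \<bullet> b = 1" "a \<bullet> b = 0" "b \<bullet> a = 0"
    using ab by (auto simp: norm_eq_1 inner_commute)
  have q_nz: "sin \<theta> *\<^sub>R a - cos \<theta> *\<^sub>R b \<noteq> 0" for \<theta>
  proof
    assume *: "sin \<theta> *\<^sub>R a - cos \<theta> *\<^sub>R b = 0"
    from arg_cong[OF *, of "\<lambda>v. a \<bullet> v"] arg_cong[OF *, of "\<lambda>v. b \<bullet> v"]
    have "sin \<theta> = 0" "cos \<theta> = 0" by (auto simp: inner_diff_right n)
    then show False using sin_cos_squared_add[of \<theta>] by simp
  qed
  have cl: "closed {v. 0 \<le> c \<bullet> v}" for c :: "(real, 'n) vec"
    using closed_halfspace_ge[of 0 c] by simp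
  have Wcl: "compact (W \<theta>)" for \<theta>
    unfolding W_def q_inner by (intro compact_Int_closed compact_cball cl)
  have Wm: "W \<theta> \<in> lmeasurable" for \<theta> using Wcl by (rule lmeasurable_compact)
  have half: "?m (?B \<inter> {v. 0 \<le> b \<bullet> v}) = ?m ?B / 2"
  proof -
    have "orthogonal_transformation (uminus :: (real, 'n) vec \<Rightarrow> (real, 'n) vec)"
      by (auto simp: orthogonal_transformation intro!: linearI)
    from measure_orthogonal_image[OF this, of "?B \<inter> {v. 0 \<le> b \<bullet> v}"]
    have "?m (uminus ` (?B \<inter> {v. 0 \<le> b \<bullet> v})) = ?m (?B \<inter> {v. 0 \<le> b \<bullet> v})"
      by (simp add: lmeasurable_compact compact_Int_closed cl)
    moreover have "uminus ` (?B \<inter> {v. 0 \<le> b \<bullet> v}) = ?B \<inter> {v. b \<bullet> v \<le> 0}"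
      by (auto simp: image_iff intro!: bexI[where x="- _"])
    ultimately show ?thesis
      using measure_split_hyperplane[of ?B b] nb by simp
  qed
  have W0: "?m (W 0) = 0"
    by (rule negligible_imp_measure0, rule negligible_subset[OF negligible_hyperplane[of b 0]])
       (use nb in \<open>auto simp: W_def\<close>)
  have Wpi: "W pi = ?B \<inter> {v. 0 \<le> b \<bullet> v}" by (auto simp: W_def)
  have add: "?m (W (s + t)) = ?m (W s) + ?m (W t)" if st: "0 \<le> s" "0 \<le> t" "s + t \<le> pi" for s t
  proof (cases "s = 0 \<or> t = 0")
    case True then show ?thesis using W0 by auto
  next
    case False
    then have pos: "0 < s" "s < pi" "0 < t" "t < pi" using st by auto
    then have sn: "sin s > 0" "sin t > 0" by (auto intro: sin_gt_zero)
    have snst: "sin (s + t) \<ge> 0" using st by (intro sin_ge_zero) auto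
    \<comment> \<open>An identity between the heights over the three bounding planes of the two adjacent wedges; it
      shows that two of the inequalities imply the third.\<close>
    have key: "(b \<bullet> v) * sin t = ?q (s + t) v * sin s - ?q s v * sin (s + t)" for v
    proof -
      have "?q (s + t) v * sin s - ?q s v * sin (s + t)
          = (b \<bullet> v) * (cos s * sin (s + t) - cos (s + t) * sin s)" by (simp add: algebra_simps)
      also have "cos s * sin (s + t) - cos (s + t) * sin s = sin ((s + t) - s)"
        by (simp only: sin_diff) (simp add: algebra_simps)
      finally show ?thesis by simp
    qed
    have c1: "?q (s + t) v \<ge> 0" if "b \<bullet> v \<ge> 0" "?q s v \<ge> 0" for v
    proof -
      have "?q (s + t) v * sin s = (b \<bullet> v) * sin t + ?q s v * sin (s + t)" using key[of v] by simp
      also have "\<dots> \<ge> 0" using that sn snst by simp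
      finally show ?thesis using sn by (simp add: zero_le_mult_iff)
    qed
    have c2: "b \<bullet> v \<ge> 0" if "?q (s + t) v \<ge> 0" "?q s v \<le> 0" for v
    proof -
      have "(b \<bullet> v) * sin t \<ge> 0"
        unfolding key using mult_nonneg_nonneg[OF that(1) less_imp_le[OF sn(1)]]
          mult_nonpos_nonneg[OF that(2) snst] by linarith
      then show ?thesis using sn by (simp add: zero_le_mult_iff)
    qed
    obtain R where R: "orthogonal_transformation R"
      "\<And>v. a \<bullet> R v = cos s * (a \<bullet> v) - sin s * (b \<bullet> v)"
      "\<And>v. b \<bullet> R v = sin s * (a \<bullet> v) + cos s * (b \<bullet> v)"
      using orthogonal_planar_rotation[OF ab, where \<theta>=s] by blast
    have RB: "R ` ?B = ?B"
      using image_orthogonal_transformation_cball[OF R(1), of 0 1] R(1)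
      by (simp add: linear_0 orthogonal_transformation_linear)
    have qR1: "?q s (R v) = - (b \<bullet> v)" for v
    proof -
      have "S * (C * p - S * q) - C * (S * p + C * q) = - ((S\<^sup>2 + C\<^sup>2) * q)" for S C p q :: real
        by (simp add: algebra_simps power2_eq_square)
      from this[of "sin s" "cos s" "a \<bullet> v" "b \<bullet> v"] show ?thesis unfolding R by simp
    qed
    have qR2: "?q (s + t) (R v) = ?q t v" for v
    proof -
      have "(S * C' + C * S') * (C * p - S * q) - (C * C' - S * S') * (S * p + C * q)
          = (S\<^sup>2 + C\<^sup>2) * (S' * p - C' * q)" for S C S' C' p q :: real
        by (simp add: algebra_simps power2_eq_square)
      from this[of "sin s" "cos t" "cos s" "sin t" "a \<bullet> v" "b \<bullet> v"] show ?thesis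
        unfolding R sin_add cos_add by simp
    qed
    have "R ` W t = ?B \<inter> {v. ?q s v \<le> 0} \<inter> {v. 0 \<le> ?q (s + t) v}"
    proof -
      have "surj R" using R(1) by (rule orthogonal_transformation_surj)
      have "R ` W t = R ` (?B \<inter> (R -` ({v. ?q s v \<le> 0} \<inter> {v. 0 \<le> ?q (s + t) v})))"
        unfolding W_def vimage_def Int_iff mem_Collect_eq qR1 qR2
        by (rule arg_cong[where f="(`) R"]) auto
      also have "\<dots> = R ` ?B \<inter> ({v. ?q s v \<le> 0} \<inter> {v. 0 \<le> ?q (s + t) v})" by auto
      finally show ?thesis unfolding RB by auto
    qed
    also have "\<dots> = W (s + t) \<inter> {v. ?q s v \<le> 0}" using c2 by (auto simp: W_def)
    finally have "?m (W (s + t) \<inter> {v. ?q s v \<le> 0}) = ?m (W t)"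
      using measure_orthogonal_image[OF R(1) Wm, of t] by (simp only:)
    moreover have "W (s + t) \<inter> {v. 0 \<le> ?q s v} = W s" using c1 by (auto simp: W_def)
    ultimately show ?thesis
      using measure_split_hyperplane[OF Wm q_nz, of "s + t" s] unfolding q_inner[symmetric] by simp
  qed
  have "?m (W \<theta>) = \<theta> / pi * ?m (W pi)"
    by (rule additive_nonneg_imp_linear[where g="\<lambda>\<theta>. ?m (W \<theta>)"]) (use \<theta> add in auto)
  then show ?thesis unfolding Wpi half by (simp add: W_def)
qed

text \<open>
  The opening angle of the wedge is the supplement of the angle between the inner normals.
\<close>

lemma measure_ball_wedge:
  fixes m n :: "real ^ 3"
  assumes mn: "\<bar>m \<bullet> n\<bar> < norm m * norm n"
  shows "measure lebesgue (cball 0 1 \<inter> {v. 0 \<le> m \<bullet> v} \<inter> {v. 0 \<le> n \<bullet> v}) = 2 / 3 * (pi - vangle m n)"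
proof -
  have nz: "norm m > 0" "norm n > 0" using mn by (auto intro!: Nat.gr0I simp: zero_less_iff_neq_zero)
  define b where "b = m /\<^sub>R norm m"
  define k where "k = n /\<^sub>R norm n"
  define \<theta> where "\<theta> = pi - vangle m n"
  have bk: "norm b = 1" "norm k = 1" using nz by (auto simp: b_def k_def)
  have bk': "b \<bullet> b = 1" "k \<bullet> k = 1" using bk by (auto simp: norm_eq_1)
  have r: "m \<bullet> n / (norm m * norm n) = b \<bullet> k" by (simp add: b_def k_def field_simps)
  have lt: "\<bar>b \<bullet> k\<bar> < 1" using mn nz unfolding r[symmetric] by (simp add: abs_mult)
  have c: "cos \<theta> = - (b \<bullet> k)" using lt by (simp add: \<theta>_def vangle_def r)
  have \<theta>: "0 < \<theta>" "\<theta> < pi"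
    using lt arccos_lt_bounded[of "b \<bullet> k"] by (auto simp: \<theta>_def vangle_def r)
  have s: "sin \<theta> > 0" using \<theta> by (rule sin_gt_zero)
  define a where "a = (k + cos \<theta> *\<^sub>R b) /\<^sub>R sin \<theta>"
  have ab: "a \<bullet> b = 0" using bk' c inner_commute[of b k] by (simp add: a_def inner_add_left inner_diff_left)
  have "(sin \<theta>)\<^sup>2 = 1 - (b \<bullet> k)\<^sup>2" by (simp add: sin_squared_eq c)
  then have "(k + cos \<theta> *\<^sub>R b) \<bullet> (k + cos \<theta> *\<^sub>R b) = (sin \<theta>)\<^sup>2"
    using bk' c inner_commute[of b k]
    by (simp add: inner_diff_left inner_diff_right power2_eq_square algebra_simps)
  then have "norm (k + cos \<theta> *\<^sub>R b) = sin \<theta>" using s by (simp add: norm_eq_sqrt_inner)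
  then have na: "norm a = 1" using s by (simp add: a_def)
  have k: "k = sin \<theta> *\<^sub>R a - cos \<theta> *\<^sub>R b" using s by (simp add: a_def)
  have "{v. 0 \<le> m \<bullet> v} = {v. 0 \<le> b \<bullet> v}" using nz by (simp add: b_def zero_le_mult_iff)
  moreover have "{v. 0 \<le> n \<bullet> v} = {v. 0 \<le> k \<bullet> v}" using nz by (simp add: k_def zero_le_mult_iff)
  moreover have "{v. 0 \<le> k \<bullet> v} = {v. 0 \<le> sin \<theta> * (a \<bullet> v) - cos \<theta> * (b \<bullet> v)}"
    by (subst k) (simp add: inner_diff_left)
  moreover have ball: "measure lebesgue (cball 0 1 :: (real ^ 3) set) = 4 / 3 * pi"
    by (simp add: content_cball unit_ball_vol_3)
  ultimately have "measure lebesgue (cball 0 1 \<inter> {v. 0 \<le> m \<bullet> v} \<inter> {v. 0 \<le> n \<bullet> v})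
      = \<theta> / (2 * pi) * (4 / 3 * pi)"
    using measure_ball_wedge_orthonormal[OF na bk(1) ab, of \<theta>, unfolded ball] \<theta> by simp
  then show ?thesis by (simp add: \<theta>_def)
qed

section \<open>Solid angles of triangles\<close>

lemma triple_product_rotate:
  fixes A B C :: "real ^ 3"
  shows "B \<bullet> cross3 C A = A \<bullet> cross3 B C" "C \<bullet> cross3 A B = A \<bullet> cross3 B C"
  by (simp_all add: cross3_simps)

lemma triple_product_swap:
  fixes A B C :: "real ^ 3"
  shows "B \<bullet> cross3 A C = - (A \<bullet> cross3 B C)"
  by (simp add: cross3_simps)

text \<open>
  Cramer's rule: the cross products of the other two vectors form, up to the factor
  \<open>A \<bullet> cross3 B C\<close>, the dual basis of \<open>A\<close>, \<open>B\<close>, \<open>C\<close>.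
\<close>

lemma scaleR_triple_product_expansion:
  fixes A B C v :: "real ^ 3"
  shows "(A \<bullet> cross3 B C) *\<^sub>R v
    = (cross3 B C \<bullet> v) *\<^sub>R A + (cross3 C A \<bullet> v) *\<^sub>R B + (cross3 A B \<bullet> v) *\<^sub>R C"
  by (simp add: cross3_simps forall_3)

lemma triple_product_squared:
  fixes A B C :: "real ^ 3"
  shows "(A \<bullet> cross3 B C)\<^sup>2 * (A \<bullet> A) =
    (norm (cross3 C A) * norm (cross3 A B))\<^sup>2 - (cross3 C A \<bullet> cross3 A B)\<^sup>2"
proof -
  have "cross3 (cross3 C A) (cross3 A B) = (A \<bullet> cross3 B C) *\<^sub>R A"
    by (simp add: cross3_simps forall_3)
  then have "(norm (cross3 (cross3 C A) (cross3 A B)))\<^sup>2 = (A \<bullet> cross3 B C)\<^sup>2 * (A \<bullet> A)"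
    by (simp add: power_mult_distrib power2_norm_eq_inner)
  then show ?thesis using norm_cross_dot[of "cross3 C A" "cross3 A B"] by simp
qed

text \<open>
  The Gram determinant of three unit vectors.
\<close>

lemma triple_product_squared_unit:
  fixes A B C :: "real ^ 3"
  assumes n: "norm A = 1" "norm B = 1" "norm C = 1"
  shows "(A \<bullet> cross3 B C)\<^sup>2 =
    1 + 2 * (A \<bullet> B) * (A \<bullet> C) * (B \<bullet> C) - (A \<bullet> B)\<^sup>2 - (A \<bullet> C)\<^sup>2 - (B \<bullet> C)\<^sup>2"
proof -
  define x y z where "x = A \<bullet> B" and "y = A \<bullet> C" and "z = B \<bullet> C"
  have sq: "A \<bullet> A = 1" using n by (simp add: norm_eq_1)
  have sym: "B \<bullet> A = x" "C \<bullet> A = y" "C \<bullet> B = z" by (simp_all add: x_def y_def z_def inner_commute)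
  have "norm (cross3 C A) ^ 2 = 1 - y\<^sup>2" "norm (cross3 A B) ^ 2 = 1 - x\<^sup>2"
    using norm_cross_dot[of C A] norm_cross_dot[of A B] n by (simp_all add: sym x_def)
  moreover have "cross3 C A \<bullet> cross3 A B = x * y - z"
    by (simp add: dot_cross sq sym) (simp add: x_def y_def)
  ultimately have "(A \<bullet> cross3 B C)\<^sup>2 = (1 - y\<^sup>2) * (1 - x\<^sup>2) - (x * y - z)\<^sup>2"
    using triple_product_squared[of A B C] sq by (simp add: power_mult_distrib)
  then show ?thesis by (simp add: x_def y_def z_def power2_eq_square algebra_simps)
qed

text \<open>
  Here \<open>\<alpha>\<close> is the dihedral angle at the edge \<open>OA\<close>, that is, the spherical angle at \<open>A\<close>. The two
  equations say that \<open>r * cis \<alpha>\<close> has a real part and an imaginary part that are polynomials in the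
  vertices; in this form the three angles can be added by multiplying complex numbers.
\<close>

lemma dihedral_angle:
  fixes A B C :: "real ^ 3"
  assumes A: "norm A = 1" and D: "A \<bullet> cross3 B C > 0"
  defines "r \<equiv> norm (cross3 C A) * norm (cross3 A B)"
    and "\<alpha> \<equiv> pi - vangle (cross3 C A) (cross3 A B)"
  shows "r > 0"
    and "r * cos \<alpha> = B \<bullet> C - (A \<bullet> B) * (A \<bullet> C)"
    and "r * sin \<alpha> = A \<bullet> cross3 B C"
    and "measure lebesgue (cball 0 1 \<inter> {v. 0 \<le> cross3 C A \<bullet> v} \<inter> {v. 0 \<le> cross3 A B \<bullet> v}) = 2 / 3 * \<alpha>"
proof -
  let ?D = "A \<bullet> cross3 B C"
  let ?p = "cross3 C A \<bullet> cross3 A B"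
  have AA: "A \<bullet> A = 1" using A by (simp add: norm_eq_1)
  have D2: "?D\<^sup>2 = r\<^sup>2 - ?p\<^sup>2" using triple_product_squared[of A B C] AA by (simp add: r_def)
  have "?D\<^sup>2 > 0" using D by simp
  then have lt: "\<bar>?p\<bar>\<^sup>2 < r\<^sup>2" using D2 by simp
  have r0: "r \<ge> 0" by (simp add: r_def)
  have plt: "\<bar>?p\<bar> < r" using lt r0 by (rule power_less_imp_less_base)
  then show r: "r > 0" by linarith
  have p: "?p = (A \<bullet> B) * (A \<bullet> C) - B \<bullet> C"
    using AA by (simp add: dot_cross inner_commute)
  have bd: "\<bar>?p / r\<bar> < 1" using plt r by simp
  have v: "vangle (cross3 C A) (cross3 A B) = arccos (?p / r)" by (simp add: vangle_def r_def)
  have "- 1 \<le> ?p / r" "?p / r \<le> 1" using bd by linarith+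
  then have "cos \<alpha> = - (?p / r)" by (simp add: \<alpha>_def v cos_arccos)
  then show "r * cos \<alpha> = B \<bullet> C - (A \<bullet> B) * (A \<bullet> C)" using r p by simp
  have "sin \<alpha> = sqrt (1 - (?p / r)\<^sup>2)" using bd by (simp add: \<alpha>_def v sin_arccos_abs)
  also have "1 - (?p / r)\<^sup>2 = (?D / r)\<^sup>2" using r D2 by (simp add: field_simps)
  finally show "r * sin \<alpha> = ?D" using r D by simp
  show "measure lebesgue (cball 0 1 \<inter> {v. 0 \<le> cross3 C A \<bullet> v} \<inter> {v. 0 \<le> cross3 A B \<bullet> v}) = 2 / 3 * \<alpha>"
    using measure_ball_wedge[of "cross3 C A" "cross3 A B"] plt by (simp add: \<alpha>_def r_def)
qed

text \<open>
  Girard's argument. Three planes through the centre cut the ball into eight pieces, opposite ones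
  of equal measure. Each of the three wedges consists of the piece over the triangle and one
  neighbour of it, and up to the central symmetry the piece and its three neighbours fill a half
  ball, of measure \<open>2 / 3 * pi\<close>.
\<close>

lemma girard_measure:
  fixes a b c :: "real ^ 3"
  assumes nz: "a \<noteq> 0" "b \<noteq> 0" "c \<noteq> 0"
  defines "X \<equiv> \<lambda>n :: real ^ 3. {v. 0 \<le> n \<bullet> v}"
  shows "2 * measure lebesgue (cball 0 1 \<inter> X a \<inter> X b \<inter> X c) + 2 / 3 * pi =
    measure lebesgue (cball 0 1 \<inter> X b \<inter> X c) + measure lebesgue (cball 0 1 \<inter> X c \<inter> X a)
    + measure lebesgue (cball 0 1 \<inter> X a \<inter> X b)"
proof -
  let ?B = "cball 0 1 :: (real ^ 3) set"
  let ?m = "measure lebesgue :: (real ^ 3) set \<Rightarrow> real"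
  define Y where "Y = (\<lambda>n :: real ^ 3. {v. n \<bullet> v \<le> 0})"
  have clX: "closed (X n)" for n
    using closed_halfspace_ge[of 0 n] by (simp add: X_def)
  have clY: "closed (Y n)" for n
    using closed_halfspace_le[of n 0] by (simp add: Y_def)
  have split: "?m S = ?m (S \<inter> X n) + ?m (S \<inter> Y n)" if "compact S" "n \<noteq> 0" for S n
    unfolding X_def Y_def by (intro measure_split_hyperplane lmeasurable_compact that)
  have orth: "orthogonal_transformation (uminus :: real ^ 3 \<Rightarrow> real ^ 3)"
    by (auto simp: orthogonal_transformation intro!: linearI)
  have flip: "?m (uminus ` S) = ?m S" if "compact S" for S
    using measure_orthogonal_image[OF orth] that by (simp add: lmeasurable_compact)
  have ball: "?m ?B = 4 / 3 * pi" by (simp add: content_cball unit_ball_vol_3)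
  note cmp = compact_Int_closed compact_cball clX clY
  \<comment> \<open>The neighbour across the third plane is antipodal to the last piece of the half ball.\<close>
  have flipXY: "uminus ` (?B \<inter> X a \<inter> X b \<inter> Y c) = ?B \<inter> Y a \<inter> Y b \<inter> X c"
    by (auto simp: image_iff X_def Y_def intro!: bexI[where x="- _"])
  have "uminus ` (?B \<inter> X c) = ?B \<inter> Y c"
    by (auto simp: image_iff X_def Y_def intro!: bexI[where x="- _"])
  then have "?m (?B \<inter> X c) = ?m (?B \<inter> Y c)"
    using flip[of "?B \<inter> X c"] by (simp add: cmp)
  then have half: "?m (?B \<inter> X c) = 2 / 3 * pi"
    using split[of ?B c] nz ball by simp
  have third: "?m (?B \<inter> Y a \<inter> Y b \<inter> X c) = ?m (?B \<inter> X a \<inter> X b \<inter> Y c)"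
    using flip[of "?B \<inter> X a \<inter> X b \<inter> Y c"] cmp flipXY by (simp add: compact_Int_closed)
  have 1: "?m (?B \<inter> X c) = ?m (?B \<inter> X c \<inter> X a) + ?m (?B \<inter> X c \<inter> Y a)"
    by (intro split cmp nz)
  have 2: "?m (?B \<inter> X c \<inter> Y a) = ?m (?B \<inter> X c \<inter> Y a \<inter> X b) + ?m (?B \<inter> X c \<inter> Y a \<inter> Y b)"
    by (intro split cmp nz)
  have 3: "?m (?B \<inter> X b \<inter> X c) = ?m (?B \<inter> X b \<inter> X c \<inter> X a) + ?m (?B \<inter> X b \<inter> X c \<inter> Y a)"
    by (intro split cmp nz)
  have 4: "?m (?B \<inter> X a \<inter> X b) = ?m (?B \<inter> X a \<inter> X b \<inter> X c) + ?m (?B \<inter> X a \<inter> X b \<inter> Y c)"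
    by (intro split cmp nz)
  have eq: "?B \<inter> X b \<inter> X c \<inter> X a = ?B \<inter> X a \<inter> X b \<inter> X c"
    "?B \<inter> X c \<inter> Y a \<inter> X b = ?B \<inter> X b \<inter> X c \<inter> Y a"
    "?B \<inter> X c \<inter> Y a \<inter> Y b = ?B \<inter> Y a \<inter> Y b \<inter> X c" by auto
  show ?thesis using 1 2 3 4 half third unfolding eq by linarith
qed

text \<open>
  By Girard's theorem \<open>\<omega> = \<alpha> + \<beta> + \<gamma> - pi\<close>. Hence \<open>cis \<omega>\<close> is a positive multiple of
  \<open>- (z - x * y + \<i> * d) * (y - x * z + \<i> * d) * (x - y * z + \<i> * d)\<close>, where \<open>x\<close>, \<open>y\<close>, \<open>z\<close> are the cosines
  of the edges and \<open>d\<close> is the triple product. The Gram determinant turns this product into a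
  positive multiple of \<open>(1 + x + y + z + \<i> * d)\<^sup>2\<close>, so \<open>cis (\<omega> / 2)\<close> is a real multiple of
  \<open>1 + x + y + z + \<i> * d\<close>.
\<close>

lemma tan_half_solid_angle:
  fixes A B C :: "real ^ 3"
  assumes n: "norm A = 1" "norm B = 1" "norm C = 1" and D: "A \<bullet> cross3 B C > 0"
  defines "\<omega> \<equiv> 3 * measure lebesgue (cball 0 1 \<inter> {v. 0 \<le> cross3 B C \<bullet> v}
                    \<inter> {v. 0 \<le> cross3 C A \<bullet> v} \<inter> {v. 0 \<le> cross3 A B \<bullet> v})"
  shows "(A \<bullet> cross3 B C) * cos (\<omega> / 2) = (1 + A \<bullet> B + A \<bullet> C + B \<bullet> C) * sin (\<omega> / 2)"
proof -
  define d where "d = A \<bullet> cross3 B C"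
  define x y z where "x = A \<bullet> B" and "y = A \<bullet> C" and "z = B \<bullet> C"
  define \<alpha> \<beta> \<gamma> where "\<alpha> = pi - vangle (cross3 C A) (cross3 A B)"
    and "\<beta> = pi - vangle (cross3 A B) (cross3 B C)" and "\<gamma> = pi - vangle (cross3 B C) (cross3 C A)"
  define r s t where "r = norm (cross3 C A) * norm (cross3 A B)"
    and "s = norm (cross3 A B) * norm (cross3 B C)" and "t = norm (cross3 B C) * norm (cross3 C A)"
  have d: "d > 0" using D by (simp add: d_def)
  have sym: "B \<bullet> A = x" "C \<bullet> A = y" "C \<bullet> B = z" by (simp_all add: x_def y_def z_def inner_commute)
  note rot = triple_product_rotate[of B C A] triple_product_rotate[of C A B]
  have Db: "B \<bullet> cross3 C A > 0" and Dc: "C \<bullet> cross3 A B > 0" using D by (simp_all add: rot)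
  note angA = dihedral_angle[OF n(1) D, folded r_def \<alpha>_def]
  note angB = dihedral_angle[OF n(2) Db, folded s_def \<beta>_def]
  note angC = dihedral_angle[OF n(3) Dc, folded t_def \<gamma>_def]
  have A1: "r * cos \<alpha> = z - x * y" "r * sin \<alpha> = d"
    using angA by (simp_all add: x_def y_def z_def d_def)
  have B1: "s * cos \<beta> = y - x * z" "s * sin \<beta> = d"
    using angB(2,3) unfolding sym z_def[symmetric] by (simp_all add: d_def rot sym mult.commute)
  have C1: "t * cos \<gamma> = x - y * z" "t * sin \<gamma> = d"
    using angC(2,3) unfolding sym x_def[symmetric] by (simp_all add: d_def rot sym)
  have "cross3 B C \<noteq> 0" "cross3 C A \<noteq> 0" "cross3 A B \<noteq> 0"
    using angA(1) angB(1) unfolding r_def s_def by auto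
  from girard_measure[OF this] have \<omega>: "\<omega> = \<alpha> + \<beta> + \<gamma> - pi"
    using angA(4) angB(4) angC(4) unfolding \<omega>_def by simp
  have D2: "d\<^sup>2 = 1 + 2 * x * y * z - x\<^sup>2 - y\<^sup>2 - z\<^sup>2"
    unfolding d_def x_def y_def z_def by (rule triple_product_squared_unit[OF n])
  define e where "e = 1 + x + y + z"
  define K where "K = (1 - x) * (1 - y) * (1 - z) / 2"
  have lt1: "P \<bullet> Q < 1" if "norm P = 1" "norm Q = 1" "norm (cross3 P Q) > 0" for P Q :: "real ^ 3"
  proof -
    have "(norm (cross3 P Q))\<^sup>2 + (P \<bullet> Q)\<^sup>2 = 1" using norm_cross_dot[of P Q] that by simp
    moreover have "(norm (cross3 P Q))\<^sup>2 > 0" using that(3) by simp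
    ultimately have "(P \<bullet> Q)\<^sup>2 < 1" by linarith
    then show ?thesis by (simp add: abs_square_less_1 abs_less_iff)
  qed
  have xyz: "x < 1" "y < 1" "z < 1"
    using lt1[of A B] lt1[of C A] lt1[of B C] n \<open>cross3 B C \<noteq> 0\<close> \<open>cross3 C A \<noteq> 0\<close> \<open>cross3 A B \<noteq> 0\<close>
    by (simp_all add: sym x_def z_def)
  then have K: "K > 0" by (simp add: K_def)
  define R where "R = r * s * t"
  have R: "R > 0" using angA(1) angB(1) angC(1) by (simp add: R_def)
  define a b c where "a = z - x * y" and "b = y - x * z" and "c = x - y * z"
  have "R * cos \<omega> = - (R * cos (\<alpha> + \<beta> + \<gamma>))" by (simp add: \<omega> cos_diff)
  also have "R * cos (\<alpha> + \<beta> + \<gamma>) = (r * cos \<alpha>) * (s * cos \<beta>) * (t * cos \<gamma>)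
     - (r * sin \<alpha>) * (s * sin \<beta>) * (t * cos \<gamma>) - (r * sin \<alpha>) * (s * cos \<beta>) * (t * sin \<gamma>)
     - (r * cos \<alpha>) * (s * sin \<beta>) * (t * sin \<gamma>)"
    by (simp add: R_def cos_add sin_add algebra_simps)
  also have "\<dots> = a * b * c - d\<^sup>2 * (a + b + c)"
    unfolding A1 B1 C1 a_def[symmetric] b_def[symmetric] c_def[symmetric]
    by (simp add: power2_eq_square algebra_simps)
  also have "- \<dots> = K * (e\<^sup>2 - d\<^sup>2)"
    unfolding D2 a_def b_def c_def K_def e_def by (simp add: power2_eq_square field_simps)
  finally have c2: "R * cos \<omega> = K * (e\<^sup>2 - d\<^sup>2)" .
  have "R * sin \<omega> = - (R * sin (\<alpha> + \<beta> + \<gamma>))" by (simp add: \<omega> sin_diff)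
  also have "R * sin (\<alpha> + \<beta> + \<gamma>) = (r * sin \<alpha>) * (s * cos \<beta>) * (t * cos \<gamma>)
     + (r * cos \<alpha>) * (s * sin \<beta>) * (t * cos \<gamma>) + (r * cos \<alpha>) * (s * cos \<beta>) * (t * sin \<gamma>)
     - (r * sin \<alpha>) * (s * sin \<beta>) * (t * sin \<gamma>)"
    by (simp add: R_def cos_add sin_add algebra_simps)
  also have "\<dots> = d * (b * c + a * c + a * b - d\<^sup>2)"
    unfolding A1 B1 C1 a_def[symmetric] b_def[symmetric] c_def[symmetric]
    by (simp add: power2_eq_square algebra_simps)
  also have "b * c + a * c + a * b - d\<^sup>2 = - 2 * K * e"
    unfolding D2 a_def b_def c_def K_def e_def by (simp add: power2_eq_square field_simps)
  finally have s2: "R * sin \<omega> = 2 * K * e * d" by simp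
  define C S where "C = cos (\<omega> / 2)" and "S = sin (\<omega> / 2)"
  have cw: "cos \<omega> = C\<^sup>2 - S\<^sup>2" using cos_double[of "\<omega> / 2"] by (simp add: C_def S_def)
  have sw: "sin \<omega> = 2 * S * C" using sin_double[of "\<omega> / 2"] by (simp add: C_def S_def)
  have CS: "C\<^sup>2 + S\<^sup>2 = 1" by (simp add: C_def S_def)
  \<comment> \<open>The half angle formulas fix \<open>C\<close> and \<open>S\<close> up to a common sign; this step excludes the other root,
    where \<open>cis (\<omega> / 2)\<close> would be orthogonal to \<open>e + \<i> * d\<close>.\<close>
  have "R = R * (cos \<omega>)\<^sup>2 + R * (sin \<omega>)\<^sup>2"
    using sin_cos_squared_add2[of \<omega>] by (simp flip: distrib_left)
  also have "\<dots> = (R * cos \<omega>) * cos \<omega> + (R * sin \<omega>) * sin \<omega>" by (simp add: power2_eq_square)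
  also have "\<dots> = K * ((e * C + d * S)\<^sup>2 - (e * S - d * C)\<^sup>2)"
    unfolding c2 s2 by (simp add: cw sw power2_eq_square algebra_simps)
  finally have "(e * C + d * S)\<^sup>2 - (e * S - d * C)\<^sup>2 > 0" using R K by (metis zero_less_mult_pos)
  then have nz: "e * C + d * S \<noteq> 0" by (auto simp: not_less)
  have "R * (cos \<omega> * (2 * e * d) - sin \<omega> * (e\<^sup>2 - d\<^sup>2)) = (R * cos \<omega>) * (2 * e * d) - (R * sin \<omega>) * (e\<^sup>2 - d\<^sup>2)"
    by (simp add: algebra_simps)
  also have "\<dots> = 0" unfolding c2 s2 by (simp add: algebra_simps)
  finally have "cos \<omega> * (2 * e * d) - sin \<omega> * (e\<^sup>2 - d\<^sup>2) = 0" using R by simp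
  moreover have "cos \<omega> * (2 * e * d) - sin \<omega> * (e\<^sup>2 - d\<^sup>2) = - 2 * ((e * C + d * S) * (e * S - d * C))"
    unfolding cw sw by (simp add: power2_eq_square algebra_simps)
  ultimately have "e * S - d * C = 0" using nz by simp
  then show ?thesis by (simp add: C_def S_def e_def d_def x_def y_def z_def)
qed

section \<open>The largest tetrahedron with a given edge and solid angle\<close>

lemma one_minus_cos_cos_pos:
  fixes s t :: real
  assumes "0 < t" "t < pi"
  shows "1 - cos s * cos t > 0"
proof -
  have "\<bar>cos t\<bar> < 1"
  proof -
    have "sin t > 0" using assms by (rule sin_gt_zero)
    then have "(sin t)\<^sup>2 > 0" by simp
    then have "(cos t)\<^sup>2 < 1" using sin_cos_squared_add[of t] by linarith
    then show ?thesis by (simp add: abs_square_less_1)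
  qed
  moreover have "\<bar>cos s\<bar> \<le> 1" by simp
  ultimately have "\<bar>cos s\<bar> * \<bar>cos t\<bar> < 1"
    by (metis abs_ge_zero le_less_trans mult_left_le mult.commute)
  then show ?thesis using abs_ge_self[of "cos s * cos t"] by (simp add: abs_mult)
qed

definition vol_h :: "real \<Rightarrow> real \<Rightarrow> real" where
  "vol_h t u = sin t * cos u * (sin u)\<^sup>2 / (1 - cos t * cos u)"

text \<open>
  In terms of the half angles \<open>t = \<tau> / 2\<close> and \<open>u = c / 2\<close> the difference of cosines in \<open>vol\<close> collapses
  to a product of sines.
\<close>

lemma vol_half_angles:
  "vol \<tau> c = vol_h (\<tau> / 2) (c / 2) / 3"
proof -
  have "cos ((\<tau> - c) / 2) - cos (\<tau> / 2) * cos (c / 2) = sin (\<tau> / 2) * sin (c / 2)"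
    by (simp add: diff_divide_distrib cos_diff)
  moreover have "sin c = 2 * sin (c / 2) * cos (c / 2)" using sin_double[of "c / 2"] by simp
  moreover have "1 / 6 * (2 * s * w) * (S * s / n) = S * w * s\<^sup>2 / n / 3" for s w S n :: real
    by (simp add: power2_eq_square mult_ac)
  ultimately show ?thesis unfolding vol_def vol_h_def by (simp only: mult.commute[of "cos (c / 2)"])
qed

text \<open>
  The variables are half the area \<open>t\<close>, the edge \<open>c\<close> between \<open>A\<close> and \<open>B\<close>, the cosines \<open>y\<close> and \<open>z\<close>
  of the edges at the apex, and the triple product \<open>d\<close>. Let \<open>p\<close> and \<open>q\<close> be the components of the
  apex along the bisector of \<open>A\<close> and \<open>B\<close> and along the normal of their plane. The apex is a unit
  vector, so \<open>(p, q)\<close> lies in the unit disc; the area puts \<open>(p, q)\<close> on a line. The volume grows with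
  \<open>q\<close>, and the upper point in which the line meets the unit circle, the isosceles position,
  gives the bound.
\<close>

lemma triple_product_le_isosceles:
  fixes c t y z d :: real
  assumes c: "0 < c" "c < pi" and t: "0 < t" "t < pi / 2" and d: "0 \<le> d"
    and gram: "d\<^sup>2 = 1 + 2 * cos c * y * z - (cos c)\<^sup>2 - y\<^sup>2 - z\<^sup>2"
    and area: "d * cos t = (1 + cos c + y + z) * sin t"
  shows "d / 6 \<le> vol (2 * t) c"
proof -
  define C S k s where "C = cos (c / 2)" and "S = sin (c / 2)" and "k = cos t" and "s = sin t"
  have C: "C > 0" and S: "S > 0" and s: "s > 0" and k: "k > 0"
    using c t by (auto simp: C_def S_def k_def s_def intro!: cos_gt_zero sin_gt_zero)
  have CS: "C\<^sup>2 + S\<^sup>2 = 1" and ks: "k\<^sup>2 + s\<^sup>2 = 1" by (simp_all add: C_def S_def k_def s_def)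
  have cc: "cos c = 2 * C\<^sup>2 - 1" using cos_double_cos[of "c / 2"] by (simp add: C_def)
  have sc: "sin c = 2 * S * C" using sin_double[of "c / 2"] by (simp add: C_def S_def)
  \<comment> \<open>Components of the apex along the normal and along the bisector of \<open>A\<close> and \<open>B\<close>.\<close>
  define q p where "q = d / (2 * S * C)" and "p = (y + z) / (2 * C)"
  have q: "q \<ge> 0" using d S C by (simp add: q_def)
  have dq: "d = 2 * S * C * q" and yz: "y + z = 2 * C * p" using S C by (simp_all add: q_def p_def)
  have S2: "S\<^sup>2 = 1 - C\<^sup>2" using CS by simp
  have "4 * S\<^sup>2 * C\<^sup>2 * (1 - p\<^sup>2 - q\<^sup>2) = 4 * S\<^sup>2 * C\<^sup>2 - S\<^sup>2 * (2 * C * p)\<^sup>2 - (2 * S * C * q)\<^sup>2"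
    by (simp add: power2_eq_square algebra_simps)
  also have "\<dots> = 4 * S\<^sup>2 * C\<^sup>2 - S\<^sup>2 * (y + z)\<^sup>2 - d\<^sup>2" by (simp only: dq yz)
  also have "\<dots> = C\<^sup>2 * (y - z)\<^sup>2"
    unfolding gram cc S2 by (simp add: power2_eq_square algebra_simps)
  finally have "4 * S\<^sup>2 * C\<^sup>2 * (1 - p\<^sup>2 - q\<^sup>2) = (C * (y - z))\<^sup>2" by (simp only: power_mult_distrib)
  then have "4 * S\<^sup>2 * C\<^sup>2 * (1 - p\<^sup>2 - q\<^sup>2) \<ge> 0" by (simp only: zero_le_power2)
  moreover have "4 * S\<^sup>2 * C\<^sup>2 > 0" using S C by simp
  ultimately have pq: "p\<^sup>2 + q\<^sup>2 \<le> 1" by (simp add: zero_le_mult_iff)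
  have "1 + cos c + y + z = 2 * C * (C + p)"
    using yz by (simp add: cc power2_eq_square distrib_left)
  then have "2 * C * (S * q * k) = 2 * C * ((C + p) * s)"
    using area unfolding dq k_def[symmetric] s_def[symmetric] by (simp add: mult_ac)
  then have "S * q * k = (C + p) * s" using C by simp
  then have ps: "p * s = S * q * k - C * s" by (simp add: algebra_simps)
  have "(p * s)\<^sup>2 + (q * s)\<^sup>2 \<le> s\<^sup>2"
    using mult_right_mono[OF pq, of "s\<^sup>2"] by (simp add: power_mult_distrib distrib_right)
  then have "(S * q * k - C * s)\<^sup>2 + (q * s)\<^sup>2 - s\<^sup>2 \<le> 0" unfolding ps by simp
  moreover have "(S * q * k - C * s)\<^sup>2 + (q * s)\<^sup>2 - s\<^sup>2
      = (q * (1 - k * C) - s * S) * (q * (1 + k * C) + s * S)"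
  proof -
    have s2: "s\<^sup>2 = 1 - k\<^sup>2" using ks by simp
    have "(S * q * k - C * s)\<^sup>2 + (q * s)\<^sup>2 - s\<^sup>2
        = S\<^sup>2 * (q * k)\<^sup>2 - 2 * S * q * k * C * s + C\<^sup>2 * s\<^sup>2 + q\<^sup>2 * s\<^sup>2 - s\<^sup>2"
      by (simp add: power2_eq_square algebra_simps)
    also have "\<dots> = q\<^sup>2 * (1 - k\<^sup>2 * C\<^sup>2) - 2 * S * q * k * C * s - s\<^sup>2 * S\<^sup>2"
      unfolding s2 S2 by (simp add: power2_eq_square algebra_simps)
    also have "\<dots> = (q * (1 - k * C) - s * S) * (q * (1 + k * C) + s * S)"
      by (simp add: power2_eq_square algebra_simps)
    finally show ?thesis .
  qed
  moreover have "q * (1 + k * C) + s * S > 0" using q k C s S by (simp add: add_nonneg_pos)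
  ultimately have "q * (1 - k * C) \<le> s * S" by (simp add: mult_le_0_iff)
  moreover have N: "1 - k * C > 0"
    using one_minus_cos_cos_pos[of "c / 2" t] c unfolding k_def C_def by (simp add: one_minus_cos_cos_pos)
  ultimately have "q \<le> s * S / (1 - k * C)" by (simp add: field_simps)
  then have "2 * S * C * q \<le> 2 * S * C * (s * S / (1 - k * C))" using S C by (intro mult_left_mono) auto
  then have "d / 6 \<le> 2 * S * C * (s * S / (1 - k * C)) / 6"
    unfolding dq by (rule divide_right_mono) simp
  also have "2 * S * C * (s * S / n) / 6 = s * C * S\<^sup>2 / n / 3" for n
    by (simp add: power2_eq_square mult_ac)
  also have "s * C * S\<^sup>2 / (1 - k * C) / 3 = vol (2 * t) c"
    by (simp add: vol_half_angles vol_h_def C_def S_def k_def s_def)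
  finally show ?thesis .
qed

text \<open>
  With \<open>w = cos (c / 2)\<close> and \<open>k = cos (\<tau> / 2)\<close> the volume is proportional to \<open>w * (1 - w\<^sup>2) / (1 - k * w)\<close>,
  whose derivative in \<open>w\<close> has the sign of \<open>1 - 3 * w\<^sup>2 + 2 * k * w ^ 3\<close>. That cubic decreases on the
  unit interval, so if it is nonnegative for the shorter edge it is nonnegative for all longer edges,
  where \<open>w\<close> is smaller.
\<close>

lemma vol_antimono_edge:
  assumes \<tau>: "0 < \<tau>" "\<tau> < pi" and ab: "0 < a" "a \<le> b" "b < pi"
    and stat: "0 \<le> 1 - 3 * (cos (a / 2))\<^sup>2 + 2 * cos (\<tau> / 2) * cos (a / 2) ^ 3"
  shows "vol \<tau> b \<le> vol \<tau> a"
proof -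
  define k u w where "k = cos (\<tau> / 2)" and "u = cos (b / 2)" and "w = cos (a / 2)"
  have k: "0 < k" "k \<le> 1" using \<tau> by (auto simp: k_def intro!: cos_gt_zero)
  have u: "0 < u" using ab by (auto simp: u_def intro!: cos_gt_zero)
  have uw: "u \<le> w" using ab unfolding u_def w_def by (intro cos_monotone_0_pi_le) auto
  have w1: "w \<le> 1" by (simp add: w_def)
  have s: "sin (\<tau> / 2) > 0" using \<tau> by (intro sin_gt_zero) auto
  have N: "1 - k * u > 0" "1 - k * w > 0"
    unfolding k_def u_def w_def using ab by (intro one_minus_cos_cos_pos; simp)+
  have kw: "k * w \<le> 1" using N by simp
  \<comment> \<open>The factor of \<open>w - u\<close> in the difference of the two volumes, expanded around \<open>u = w\<close>.\<close>
  have "0 \<le> (1 - 3 * w\<^sup>2 + 2 * k * w ^ 3) + (w - u) * ((2 * w + u) * (1 - k * w))"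
    using stat[folded k_def w_def] u uw kw
    by (intro add_nonneg_nonneg[of "1 - 3 * w\<^sup>2 + 2 * k * w ^ 3"] mult_nonneg_nonneg) simp_all
  then have br: "0 \<le> (w - u) * (1 - (w\<^sup>2 + u * w + u\<^sup>2) + k * u * w * (u + w))"
    using uw by (intro mult_nonneg_nonneg) (simp_all add: power2_eq_square power3_eq_cube algebra_simps)
  have "(1 - w\<^sup>2) * w * (1 - k * u) - (1 - u\<^sup>2) * u * (1 - k * w)
      = (w - u) * (1 - (w\<^sup>2 + u * w + u\<^sup>2) + k * u * w * (u + w))"
    by (simp add: power2_eq_square algebra_simps)
  with br have "(1 - u\<^sup>2) * u * (1 - k * w) \<le> (1 - w\<^sup>2) * w * (1 - k * u)" by linarith
  then have "(1 - u\<^sup>2) * u / (1 - k * u) \<le> (1 - w\<^sup>2) * w / (1 - k * w)"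
    using N by (simp add: divide_le_eq le_divide_eq mult_ac)
  then have "sin (\<tau> / 2) * ((1 - u\<^sup>2) * u / (1 - k * u)) / 3 \<le> sin (\<tau> / 2) * ((1 - w\<^sup>2) * w / (1 - k * w)) / 3"
    using s by (intro divide_right_mono mult_left_mono) auto
  moreover have "vol \<tau> x = sin (\<tau> / 2) * ((1 - (cos (x / 2))\<^sup>2) * cos (x / 2) / (1 - k * cos (x / 2))) / 3" for x
    unfolding vol_half_angles vol_h_def sin_squared_eq k_def by (simp only: times_divide_eq_right mult_ac)
  ultimately show ?thesis by (simp only: u_def w_def)
qed

section \<open>Concavity of the volume function at regular triangles\<close>

text \<open>
  The partial derivative of \<open>vol\<close> with respect to the edge is a negative multiple of this
  expression. For angles below a right angle, its zeros are the pairs of half area and half edge of the regular spherical triangles.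
\<close>

definition edge_slope :: "real \<Rightarrow> real \<Rightarrow> real" where
  "edge_slope t u = 1 - 3 * (cos u)\<^sup>2 + 2 * cos t * cos u ^ 3"

text \<open>
  The suffixes \<open>t\<close> and \<open>u\<close> denote partial derivatives of \<open>vol_h\<close>. The factor \<open>edge_slope\<close> is kept
  in the formulas because the second derivatives are evaluated at its zeros.
\<close>

definition vol_t :: "real \<Rightarrow> real \<Rightarrow> real" where
  "vol_t t u = cos u * (sin u)\<^sup>2 * (cos t - cos u) / (1 - cos t * cos u)\<^sup>2"

definition vol_u :: "real \<Rightarrow> real \<Rightarrow> real" where
  "vol_u t u = - (sin t * sin u * edge_slope t u) / (1 - cos t * cos u)\<^sup>2"

definition vol_tt :: "real \<Rightarrow> real \<Rightarrow> real" where
  "vol_tt t u = - (sin t * cos u * (sin u)\<^sup>2 * (1 + cos t * cos u - 2 * (cos u)\<^sup>2)) / (1 - cos t * cos u) ^ 3"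

definition vol_tu :: "real \<Rightarrow> real \<Rightarrow> real" where
  "vol_tu t u = - (sin u * ((cos t * edge_slope t u - 2 * (sin t)\<^sup>2 * cos u ^ 3) * (1 - cos t * cos u)
      - 2 * (sin t)\<^sup>2 * cos u * edge_slope t u)) / (1 - cos t * cos u) ^ 3"

definition vol_uu :: "real \<Rightarrow> real \<Rightarrow> real" where
  "vol_uu t u = - (sin t * (cos u * edge_slope t u * (1 - cos t * cos u)
      + 6 * cos u * (sin u)\<^sup>2 * (1 - cos t * cos u)\<^sup>2 - 2 * cos t * (sin u)\<^sup>2 * edge_slope t u))
      / (1 - cos t * cos u) ^ 3"

lemma has_real_derivative_divide_power2:
  assumes "(f has_real_derivative f') (at s)" "(g has_real_derivative g') (at s)" "g s \<noteq> 0"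
  shows "((\<lambda>s. f s / (g s)\<^sup>2) has_real_derivative (f' * g s - 2 * f s * g') / g s ^ 3) (at s)"
proof -
  have "((\<lambda>s. (g s)\<^sup>2) has_real_derivative 2 * g s * g') (at s)"
    using DERIV_power[OF assms(2), of 2] by (simp add: mult_ac)
  from DERIV_divide[OF assms(1) this] show ?thesis
    by (rule DERIV_cong) (use assms(3) in \<open>simp_all add: field_simps power2_eq_square power3_eq_cube\<close>)
qed

text \<open>
  A function is concave on a ball if it is concave along segments. So the derivatives are taken
  along a curve \<open>(T, U)\<close>, which for a segment is affine with velocity \<open>(a, b)\<close>.
\<close>

context
  fixes T U :: "real \<Rightarrow> real" and a b s :: real
  assumes T: "(T has_real_derivative a) (at s)" and U: "(U has_real_derivative b) (at s)"
    and N: "1 - cos (T s) * cos (U s) \<noteq> 0"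
begin

lemma denominator_deriv:
  "((\<lambda>s. 1 - cos (T s) * cos (U s)) has_real_derivative
     a * sin (T s) * cos (U s) + b * cos (T s) * sin (U s)) (at s)"
  by (rule DERIV_cong, (rule derivative_eq_intros T U refl)+) simp

lemma edge_slope_deriv:
  "((\<lambda>s. edge_slope (T s) (U s)) has_real_derivative
     b * 6 * cos (U s) * sin (U s) * (1 - cos (T s) * cos (U s)) - a * 2 * sin (T s) * cos (U s) ^ 3) (at s)"
  unfolding edge_slope_def
  by (rule DERIV_cong, (rule derivative_eq_intros T U refl)+)
     (simp add: power2_eq_square power3_eq_cube algebra_simps)

lemma vol_h_deriv:
  "((\<lambda>s. vol_h (T s) (U s)) has_real_derivative a * vol_t (T s) (U s) + b * vol_u (T s) (U s)) (at s)"
proof -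
  define S k \<sigma> w where "S = sin (T s)" and "k = cos (T s)" and "\<sigma> = sin (U s)" and "w = cos (U s)"
  have sq: "S\<^sup>2 = 1 - k\<^sup>2" "\<sigma>\<^sup>2 = 1 - w\<^sup>2" by (simp_all add: S_def k_def \<sigma>_def w_def sin_squared_eq)
  have num: "((\<lambda>s. sin (T s) * cos (U s) * (sin (U s))\<^sup>2) has_real_derivative
      a * k * w * \<sigma>\<^sup>2 + b * S * \<sigma> * (2 * w\<^sup>2 - \<sigma>\<^sup>2)) (at s)"
    by (rule DERIV_cong, (rule derivative_eq_intros T U refl)+)
       (simp add: S_def k_def \<sigma>_def w_def power2_eq_square algebra_simps)
  have alg: "(a * k * w * \<sigma>\<^sup>2 + b * S * \<sigma> * (2 * w\<^sup>2 - \<sigma>\<^sup>2)) * (1 - k * w)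
      - (S * w * \<sigma>\<^sup>2) * (a * S * w + b * k * \<sigma>)
      = a * (w * \<sigma>\<^sup>2 * (k - w)) + b * (- (S * \<sigma> * (1 - 3 * w\<^sup>2 + 2 * k * w ^ 3)))"
    using sq by algebra
  show ?thesis
    unfolding vol_h_def vol_t_def vol_u_def edge_slope_def
    by (rule DERIV_cong[OF DERIV_divide[OF num denominator_deriv N]])
       (simp only: alg[symmetric] power2_eq_square[of "1 - _"] add_divide_distrib[symmetric] times_divide_eq_right
         flip: S_def k_def \<sigma>_def w_def)
qed

lemma vol_t_deriv:
  "((\<lambda>s. vol_t (T s) (U s)) has_real_derivative a * vol_tt (T s) (U s) + b * vol_tu (T s) (U s)) (at s)"
proof -
  define S k \<sigma> w where "S = sin (T s)" and "k = cos (T s)" and "\<sigma> = sin (U s)" and "w = cos (U s)"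
  have sq: "S\<^sup>2 = 1 - k\<^sup>2" "\<sigma>\<^sup>2 = 1 - w\<^sup>2" by (simp_all add: S_def k_def \<sigma>_def w_def sin_squared_eq)
  have num: "((\<lambda>s. cos (U s) * (sin (U s))\<^sup>2 * (cos (T s) - cos (U s))) has_real_derivative
      - (a * w * \<sigma>\<^sup>2 * S) + b * \<sigma> * ((2 * w\<^sup>2 - \<sigma>\<^sup>2) * (k - w) + w * \<sigma>\<^sup>2)) (at s)"
    by (rule DERIV_cong, (rule derivative_eq_intros T U refl)+)
       (simp add: S_def k_def \<sigma>_def w_def power2_eq_square algebra_simps)
  have alg: "(- (a * w * \<sigma>\<^sup>2 * S) + b * \<sigma> * ((2 * w\<^sup>2 - \<sigma>\<^sup>2) * (k - w) + w * \<sigma>\<^sup>2)) * (1 - k * w)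
      - 2 * (w * \<sigma>\<^sup>2 * (k - w)) * (a * S * w + b * k * \<sigma>)
      = a * (- (S * w * \<sigma>\<^sup>2 * (1 + k * w - 2 * w\<^sup>2)))
        + b * (- (\<sigma> * ((k * (1 - 3 * w\<^sup>2 + 2 * k * w ^ 3) - 2 * S\<^sup>2 * w ^ 3) * (1 - k * w)
            - 2 * S\<^sup>2 * w * (1 - 3 * w\<^sup>2 + 2 * k * w ^ 3))))"
    using sq by algebra
  show ?thesis
    unfolding vol_t_def vol_tt_def vol_tu_def edge_slope_def
    by (rule DERIV_cong[OF has_real_derivative_divide_power2[OF num denominator_deriv N]])
       (simp only: alg[symmetric] add_divide_distrib[symmetric] times_divide_eq_right
         flip: S_def k_def \<sigma>_def w_def)
qed

lemma vol_u_deriv: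
  "((\<lambda>s. vol_u (T s) (U s)) has_real_derivative a * vol_tu (T s) (U s) + b * vol_uu (T s) (U s)) (at s)"
proof -
  define S k \<sigma> w where "S = sin (T s)" and "k = cos (T s)" and "\<sigma> = sin (U s)" and "w = cos (U s)"
  define q where "q = edge_slope (T s) (U s)"
  have num: "((\<lambda>s. - (sin (T s) * sin (U s) * edge_slope (T s) (U s))) has_real_derivative
      - (a * k * \<sigma> * q + b * S * w * q
         + S * \<sigma> * (b * 6 * w * \<sigma> * (1 - k * w) - a * 2 * S * w ^ 3))) (at s)"
    by (rule DERIV_cong, (rule derivative_eq_intros T U edge_slope_deriv refl)+)
       (simp add: S_def k_def \<sigma>_def w_def q_def power2_eq_square algebra_simps)
  have alg: "- (a * k * \<sigma> * q + b * S * w * q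
         + S * \<sigma> * (b * 6 * w * \<sigma> * (1 - k * w) - a * 2 * S * w ^ 3)) * (1 - k * w)
      - 2 * (- (S * \<sigma> * q)) * (a * S * w + b * k * \<sigma>)
      = a * (- (\<sigma> * ((k * q - 2 * S\<^sup>2 * w ^ 3) * (1 - k * w) - 2 * S\<^sup>2 * w * q)))
        + b * (- (S * (w * q * (1 - k * w) + 6 * w * \<sigma>\<^sup>2 * (1 - k * w)\<^sup>2 - 2 * k * \<sigma>\<^sup>2 * q)))"
    by algebra
  show ?thesis
    unfolding vol_u_def vol_tu_def vol_uu_def
    by (rule DERIV_cong[OF has_real_derivative_divide_power2[OF num denominator_deriv N]])
       (simp only: alg[symmetric] add_divide_distrib[symmetric] times_divide_eq_right
         flip: S_def k_def \<sigma>_def w_def q_def)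
qed

end

text \<open>
  The equation \<open>edge_slope t u = 0\<close> expresses \<open>cos t\<close> as a rational function of \<open>w = cos u\<close>. After
  eliminating \<open>cos t\<close>, both signs reduce to \<open>w\<^sup>2 < 1\<close> and \<open>1 < 4 * w\<^sup>2\<close>, and the latter follows
  from \<open>4 * w ^ 6 * (sin t)\<^sup>2 = (1 - w\<^sup>2)\<^sup>2 * (4 * w\<^sup>2 - 1)\<close>.
\<close>

lemma hessian_pos_at_stationary_edge:
  assumes t: "0 < t" "t < pi / 2" and u: "0 < u" "u < pi / 2" and q: "edge_slope t u = 0"
  shows "vol_tt t u < 0" and "vol_tt t u * vol_uu t u - (vol_tu t u)\<^sup>2 > 0"
proof -
  define S k \<sigma> w where "S = sin t" and "k = cos t" and "\<sigma> = sin u" and "w = cos u"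
  have pos: "S > 0" "k > 0" "\<sigma> > 0" "w > 0"
    using t u by (auto simp: S_def k_def \<sigma>_def w_def intro!: cos_gt_zero sin_gt_zero)
  have S2: "S\<^sup>2 = 1 - k\<^sup>2" and \<sigma>2: "\<sigma>\<^sup>2 = 1 - w\<^sup>2" by (simp_all add: S_def k_def \<sigma>_def w_def sin_squared_eq)
  have q0: "1 - 3 * w\<^sup>2 + 2 * k * w ^ 3 = 0" using q by (simp add: edge_slope_def k_def w_def)
  have N: "1 - k * w > 0" unfolding k_def w_def using u by (intro one_minus_cos_cos_pos) auto
  have w2: "w\<^sup>2 > 0" using pos by simp
  have w1: "1 - w\<^sup>2 > 0" using pos \<sigma>2 by (metis zero_less_power)
  \<comment> \<open>Squaring the equation for \<open>k\<close> and using \<open>S\<^sup>2 = 1 - k\<^sup>2\<close>.\<close>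
  have sin_eq: "4 * w ^ 6 * S\<^sup>2 = (1 - w\<^sup>2)\<^sup>2 * (4 * w\<^sup>2 - 1)" using S2 q0 by algebra
  have "4 * w ^ 6 * S\<^sup>2 > 0" using pos by simp
  then have w4: "4 * w\<^sup>2 - 1 > 0" using w1 unfolding sin_eq by (simp add: zero_less_mult_iff)
  have M_eq: "2 * w\<^sup>2 * (1 + k * w - 2 * w\<^sup>2) = (1 - w\<^sup>2) * (4 * w\<^sup>2 - 1)" using q0 by algebra
  have "2 * w\<^sup>2 * (1 + k * w - 2 * w\<^sup>2) > 0" unfolding M_eq using w1 w4 by simp
  then have M: "1 + k * w - 2 * w\<^sup>2 > 0" using w2 by (simp add: zero_less_mult_iff)
  have tt: "vol_tt t u = - (S * w * \<sigma>\<^sup>2 * (1 + k * w - 2 * w\<^sup>2)) / (1 - k * w) ^ 3"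
    by (simp add: vol_tt_def S_def k_def \<sigma>_def w_def)
  have tu: "vol_tu t u = 2 * \<sigma> * S\<^sup>2 * w ^ 3 / (1 - k * w)\<^sup>2"
  proof -
    have "- (\<sigma> * ((k * 0 - 2 * S\<^sup>2 * w ^ 3) * n - 2 * S\<^sup>2 * w * 0)) / n ^ 3 = 2 * \<sigma> * S\<^sup>2 * w ^ 3 / n\<^sup>2"
      if "n > 0" for n :: real
      using that by (simp add: field_simps power2_eq_square power3_eq_cube)
    from this[OF N] show ?thesis
      unfolding vol_tu_def q S_def[symmetric] k_def[symmetric] \<sigma>_def[symmetric] w_def[symmetric] .
  qed
  have uu: "vol_uu t u = - (6 * S * w * \<sigma>\<^sup>2) / (1 - k * w)"
  proof -
    have "- (S * (w * 0 * n + 6 * w * \<sigma>\<^sup>2 * n\<^sup>2 - 2 * k * \<sigma>\<^sup>2 * 0)) / n ^ 3 = - (6 * S * w * \<sigma>\<^sup>2) / n"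
      if "n > 0" for n :: real
      using that by (simp add: field_simps power2_eq_square power3_eq_cube)
    from this[OF N] show ?thesis
      unfolding vol_uu_def q S_def[symmetric] k_def[symmetric] \<sigma>_def[symmetric] w_def[symmetric] .
  qed
  show "vol_tt t u < 0" unfolding tt using pos M N by (simp add: divide_neg_pos)
  have br: "w\<^sup>2 * (3 * \<sigma>\<^sup>2 * (1 + k * w - 2 * w\<^sup>2) - 2 * S\<^sup>2 * w ^ 4) = (1 - w\<^sup>2)\<^sup>2 * (4 * w\<^sup>2 - 1)"
    using M_eq sin_eq \<sigma>2 by algebra
  have "w\<^sup>2 * (3 * \<sigma>\<^sup>2 * (1 + k * w - 2 * w\<^sup>2) - 2 * S\<^sup>2 * w ^ 4) > 0"
    unfolding br using w1 w4 by simp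
  then have br0: "3 * \<sigma>\<^sup>2 * (1 + k * w - 2 * w\<^sup>2) - 2 * S\<^sup>2 * w ^ 4 > 0" using w2 by (simp add: zero_less_mult_iff)
  have "vol_tt t u * vol_uu t u - (vol_tu t u)\<^sup>2
      = 2 * \<sigma>\<^sup>2 * S\<^sup>2 * w\<^sup>2 * (3 * \<sigma>\<^sup>2 * (1 + k * w - 2 * w\<^sup>2) - 2 * S\<^sup>2 * w ^ 4) / (1 - k * w) ^ 4"
  proof -
    have "X / n ^ 3 * (Y / n) - (Z / n\<^sup>2)\<^sup>2 = (X * Y - Z\<^sup>2) / n ^ 4" if "n > 0" for X Y Z n :: real
      using that by (simp add: field_simps power2_eq_square power3_eq_cube power4_eq_xxxx)
    note this[OF N]
    moreover have "- (S * w * \<sigma>\<^sup>2 * M) * - (6 * S * w * \<sigma>\<^sup>2) - (2 * \<sigma> * S\<^sup>2 * w ^ 3)\<^sup>2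
        = 2 * \<sigma>\<^sup>2 * S\<^sup>2 * w\<^sup>2 * (3 * \<sigma>\<^sup>2 * M - 2 * S\<^sup>2 * w ^ 4)" for M
      by algebra
    ultimately show ?thesis unfolding tt uu tu by simp
  qed
  also have "\<dots> > 0" using br0 pos N by simp
  finally show "vol_tt t u * vol_uu t u - (vol_tu t u)\<^sup>2 > 0" .
qed

text \<open>
  The Hessian is negative definite at the point and, by continuity, on a ball around it; so the
  second derivative along each segment in that ball is nonpositive.
\<close>

lemma vol_locally_concave_at_stationary_edge:
  assumes \<tau>: "0 < \<tau>" "\<tau> < pi" and c: "0 < c" "c < pi" and q: "edge_slope (\<tau> / 2) (c / 2) = 0"
  shows "\<exists>e>0. concave_on (ball (\<tau>, c) e) (\<lambda>(\<tau>, c). vol \<tau> c)"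
proof -
  let ?N = "\<lambda>p :: real \<times> real. 1 - cos (fst p / 2) * cos (snd p / 2)"
  let ?X = "\<lambda>p :: real \<times> real. vol_tt (fst p / 2) (snd p / 2)"
  let ?Y = "\<lambda>p :: real \<times> real. vol_tu (fst p / 2) (snd p / 2)"
  let ?Z = "\<lambda>p :: real \<times> real. vol_uu (fst p / 2) (snd p / 2)"
  let ?p = "(\<tau>, c)"
  have N0: "?N ?p > 0" using c one_minus_cos_cos_pos[of "c / 2" "\<tau> / 2"] by simp
  have cN: "isCont ?N ?p" by (intro continuous_intros) auto
  have cX: "isCont ?X ?p" unfolding vol_tt_def by (intro continuous_intros) (use N0 in auto)
  have cY: "isCont ?Y ?p" unfolding vol_tu_def edge_slope_def by (intro continuous_intros) (use N0 in auto)
  have cZ: "isCont ?Z ?p" unfolding vol_uu_def edge_slope_def by (intro continuous_intros) (use N0 in auto)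
  have cD: "isCont (\<lambda>p. ?X p * ?Z p - (?Y p)\<^sup>2) ?p" by (intro continuous_intros cX cY cZ)
  note h = hessian_pos_at_stationary_edge[of "\<tau> / 2" "c / 2"]
  have X0: "?X ?p < 0" and D0: "?X ?p * ?Z ?p - (?Y ?p)\<^sup>2 > 0" using h \<tau> c q by auto
  have gt: "\<forall>\<^sub>F p in nhds ?p. f p > 0" if "isCont f ?p" "f ?p > 0" for f :: "real \<times> real \<Rightarrow> real"
    using that order_tendstoD(1) tendsto_at_iff_tendsto_nhds unfolding isCont_def by blast
  have lt: "\<forall>\<^sub>F p in nhds ?p. f p < 0" if "isCont f ?p" "f ?p < 0" for f :: "real \<times> real \<Rightarrow> real"
    using that order_tendstoD(2) tendsto_at_iff_tendsto_nhds unfolding isCont_def by blast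
  have ev: "\<forall>\<^sub>F p in nhds ?p. ?N p > 0 \<and> ?X p < 0 \<and> ?X p * ?Z p - (?Y p)\<^sup>2 > 0"
    by (intro eventually_conj gt[OF cN N0] lt[OF cX X0] gt[OF cD D0])
  then obtain e where e: "e > 0" and
    B: "\<And>p. p \<in> ball ?p e \<Longrightarrow> ?N p > 0 \<and> ?X p < 0 \<and> ?X p * ?Z p - (?Y p)\<^sup>2 > 0"
    unfolding eventually_nhds_metric by (auto simp: dist_commute)
  have "concave_on (ball ?p e) (\<lambda>(\<tau>, c). vol \<tau> c)"
    unfolding concave_on_iff
  proof (intro conjI ballI allI impI)
    fix x y :: "real \<times> real" and u v :: real
    assume x: "x \<in> ball ?p e" and y: "y \<in> ball ?p e" and uv: "0 \<le> u" "0 \<le> v" "u + v = 1"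
    then have uv_eq: "u = 1 - v" and v1: "v \<le> 1" by linarith+
    define a b where "a = (fst y - fst x) / 2" and "b = (snd y - snd x) / 2"
    define T U where "T = (\<lambda>s. fst x / 2 + s * a)" and "U = (\<lambda>s. snd x / 2 + s * b)"
    have T: "(T has_real_derivative a) (at s)" and U: "(U has_real_derivative b) (at s)" for s
      unfolding T_def U_def by (auto intro!: derivative_eq_intros)
    have pt: "(1 - s) *\<^sub>R x + s *\<^sub>R y = (2 * T s, 2 * U s)" for s
      by (simp add: T_def U_def a_def b_def prod_eq_iff field_simps)
    have inb: "(2 * T s, 2 * U s) \<in> ball ?p e" if "s \<in> {0..1}" for s
      using convexD[OF convex_ball x y, of "1 - s" s] that pt[of s] by simp
    have "concave_on {0..1} (\<lambda>s. vol_h (T s) (U s))"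
    proof (rule f''_le0_imp_concave)
      fix s :: real assume s: "s \<in> {0..1}"
      have C: "1 - cos (T s) * cos (U s) > 0" "vol_tt (T s) (U s) < 0"
        "vol_tt (T s) (U s) * vol_uu (T s) (U s) - (vol_tu (T s) (U s))\<^sup>2 > 0"
        using B[OF inb[OF s]] by simp_all
      then have N: "1 - cos (T s) * cos (U s) \<noteq> 0" by simp
      show "((\<lambda>s. vol_h (T s) (U s)) has_real_derivative a * vol_t (T s) (U s) + b * vol_u (T s) (U s)) (at s)"
        by (rule vol_h_deriv[OF T U N])
      show "((\<lambda>s. a * vol_t (T s) (U s) + b * vol_u (T s) (U s)) has_real_derivative
          a * (a * vol_tt (T s) (U s) + b * vol_tu (T s) (U s)) + b * (a * vol_tu (T s) (U s) + b * vol_uu (T s) (U s))) (at s)"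
        by (intro DERIV_add DERIV_cmult vol_t_deriv[OF T U N] vol_u_deriv[OF T U N])
      define X Y Z where "X = vol_tt (T s) (U s)" and "Y = vol_tu (T s) (U s)" and "Z = vol_uu (T s) (U s)"
      have "X * (a * (a * X + b * Y) + b * (a * Y + b * Z)) = (a * X + b * Y)\<^sup>2 + b\<^sup>2 * (X * Z - Y\<^sup>2)"
        by (simp add: power2_eq_square algebra_simps)
      also have "\<dots> \<ge> 0" using C(3) by (simp add: X_def Y_def Z_def)
      finally show "a * (a * vol_tt (T s) (U s) + b * vol_tu (T s) (U s)) + b * (a * vol_tu (T s) (U s) + b * vol_uu (T s) (U s)) \<le> 0"
        using C(2) unfolding X_def[symmetric] Y_def[symmetric] Z_def[symmetric] by (simp add: zero_le_mult_iff)
    qed simp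
    then have "vol_h (T v) (U v) \<ge> u * vol_h (T 0) (U 0) + v * vol_h (T 1) (U 1)"
      using concave_onD[of "{0..1}" "\<lambda>s. vol_h (T s) (U s)" v 0 1] uv(2) v1 uv_eq by simp
    moreover have "u *\<^sub>R x + v *\<^sub>R y = (2 * T v, 2 * U v)" using pt[of v] by (simp only: uv_eq)
    moreover have "x = (2 * T 0, 2 * U 0)" "y = (2 * T 1, 2 * U 1)" using pt[of 0] pt[of 1] by (simp_all flip: zero_prod_def)
    moreover have "(\<lambda>(\<tau>, c). vol \<tau> c) (2 * T s, 2 * U s) = vol_h (T s) (U s) / 3" for s
      by (simp add: vol_half_angles)
    ultimately show "u * (case x of (\<tau>, c) \<Rightarrow> vol \<tau> c) + v * (case y of (\<tau>, c) \<Rightarrow> vol \<tau> c)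
        \<le> (case u *\<^sub>R x + v *\<^sub>R y of (\<tau>, c) \<Rightarrow> vol \<tau> c)"
      by (metis (no_types, lifting) add_divide_distrib divide_right_mono times_divide_eq_right zero_le_numeral)
  qed simp
  with e show ?thesis by blast
qed

section \<open>The separating function and Jensen's inequality\<close>

lemma c_max_bounds: "pi / 2 < c_max" "c_max < pi" and cos_half_c_max: "(cos (c_max / 2))\<^sup>2 = 1 / 3" "cos (c_max / 2) > 0"
proof -
  have r: "sqrt (2 / 3) < 1" by (rule real_less_lsqrt) auto
  have c: "c_max / 2 = arcsin (sqrt (2 / 3))" by (simp add: c_max_def)
  have r0: "- 1 < sqrt (2 / 3)" by (rule less_le_trans[of _ 0]) auto
  have s: "sin (c_max / 2) = sqrt (2 / 3)" unfolding c using r r0 by (intro sin_arcsin) auto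
  have lt: "- (pi / 2) < c_max / 2" "c_max / 2 < pi / 2"
    unfolding c using arcsin_lt_bounded[OF r0 r] by simp_all
  then show "c_max < pi" "cos (c_max / 2) > 0" by (auto intro: cos_gt_zero_pi)
  show "(cos (c_max / 2))\<^sup>2 = 1 / 3" by (simp add: cos_squared_eq s)
  show "pi / 2 < c_max"
  proof (rule ccontr)
    assume "\<not> pi / 2 < c_max"
    then have "sin (c_max / 2) \<le> sin (pi / 4)" using lt by (intro sin_monotone_2pi_le) auto
    then have "(sqrt (2 / 3))\<^sup>2 \<le> (sin (pi / 4))\<^sup>2" unfolding s by (intro power_mono) auto
    then show False by (simp add: sin_45 power_divide)
  qed
qed

text \<open>
  At \<open>c_max\<close> the edge slope is positive. Were it negative at \<open>\<phi> \<tau>\<close>, it would vanish at some \<open>c\<close>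
  between them; then \<open>(\<tau>, c)\<close> would be a point of \<open>region_D'\<close> near which \<open>vol\<close> is concave. To the
  right of \<open>\<omega>\<close> the only possible value of \<open>\<phi> \<tau>\<close> is \<open>c_max\<close> itself.
\<close>

lemma separating_function_edge_slope_nonneg:
  assumes sep: "separating_function \<phi>" and \<tau>: "0 < \<tau>" "\<tau> < pi / 2" and \<phi>: "0 < \<phi> \<tau>" "\<phi> \<tau> \<le> c_max"
  shows "0 \<le> edge_slope (\<tau> / 2) (\<phi> \<tau> / 2)"
proof -
  have k: "cos (\<tau> / 2) > 0" using \<tau> by (intro cos_gt_zero) auto
  have max: "0 \<le> edge_slope (\<tau> / 2) (c_max / 2)"
    using k cos_half_c_max by (simp add: edge_slope_def)
  obtain \<omega> where \<omega>: "\<And>\<tau>. \<tau> \<in> {\<omega><..<pi/2} \<Longrightarrow> min (\<phi> \<tau>) c_max = c_max"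
    "\<And>p e. p \<in> region_D' \<phi> \<omega> \<Longrightarrow> e > 0 \<Longrightarrow> \<not> concave_on (ball p e) (\<lambda>(\<tau>, c). vol \<tau> c)"
    using sep unfolding separating_function_def by blast
  show ?thesis
  proof (cases "\<tau> \<le> \<omega>")
    case False
    then have "\<phi> \<tau> = c_max" using \<omega>(1)[of \<tau>] \<tau> \<phi> by auto
    then show ?thesis using max by simp
  next
    case True
    show ?thesis
    proof (rule ccontr)
      assume "\<not> ?thesis"
      then have "\<exists>c. \<phi> \<tau> \<le> c \<and> c \<le> c_max \<and> edge_slope (\<tau> / 2) (c / 2) = 0"
        using max \<phi> by (intro IVT) (auto simp: edge_slope_def intro!: continuous_intros)
      then obtain c where c: "\<phi> \<tau> \<le> c" "c \<le> c_max" "edge_slope (\<tau> / 2) (c / 2) = 0" by blast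
      then have "(\<tau>, c) \<in> region_D' \<phi> \<omega>" using \<tau> True by (simp add: region_D'_def)
      moreover have "\<exists>e>0. concave_on (ball (\<tau>, c) e) (\<lambda>(\<tau>, c). vol \<tau> c)"
        using \<tau> \<phi> c c_max_bounds by (intro vol_locally_concave_at_stationary_edge) auto
      ultimately show False using \<omega>(2) by blast
    qed
  qed
qed

text \<open>
  On and below the diagonal \<open>cos (\<tau> / 2) \<le> w\<close> for \<open>w = cos (\<phi> \<tau> / 2)\<close>, so the edge slope is at most
  \<open>(1 - w\<^sup>2) * (1 - 2 * w\<^sup>2)\<close>, which is negative because \<open>\<tau> < pi / 2\<close>. This would contradict
  \<open>separating_function_edge_slope_nonneg\<close>.
\<close>

lemma separating_function_above_diagonal:
  assumes sep: "separating_function \<phi>" and \<tau>: "0 < \<tau>" "\<tau> < pi / 2" and \<phi>: "0 < \<phi> \<tau>"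
  shows "\<tau> < \<phi> \<tau>"
proof (rule ccontr)
  assume "\<not> \<tau> < \<phi> \<tau>"
  then have le: "\<phi> \<tau> \<le> \<tau>" by simp
  define k w where "k = cos (\<tau> / 2)" and "w = cos (\<phi> \<tau> / 2)"
  have "0 \<le> edge_slope (\<tau> / 2) (\<phi> \<tau> / 2)"
    using le \<tau> \<phi> c_max_bounds by (intro separating_function_edge_slope_nonneg[OF sep]) auto
  then have nonneg: "0 \<le> 1 - 3 * w\<^sup>2 + 2 * k * w ^ 3" by (simp add: edge_slope_def k_def w_def)
  have kw: "k \<le> w" using le \<tau> \<phi> unfolding k_def w_def by (intro cos_monotone_0_pi_le) auto
  have "cos (pi / 4) < k" using \<tau> unfolding k_def by (intro cos_monotone_0_pi) auto
  then have k: "sqrt 2 / 2 < k" by (simp add: cos_45)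
  have "sqrt 2 / 2 < w" using k kw by simp
  then have "(sqrt 2 / 2)\<^sup>2 < w\<^sup>2" by (intro power_strict_mono) auto
  then have w2: "1 / 2 < w\<^sup>2" by (simp add: power_divide)
  have "0 < sqrt 2 / 2" by simp
  then have wpos: "w > 0" using k kw by linarith
  have "w < cos 0" using \<phi> le \<tau> unfolding w_def by (intro cos_monotone_0_pi) auto
  then have "w\<^sup>2 < 1" using wpos by (simp add: abs_square_less_1)
  then have "(1 - w\<^sup>2) * (1 - 2 * w\<^sup>2) < 0" using w2 by (simp add: mult_pos_neg)
  moreover have "2 * k * w ^ 3 \<le> 2 * w * w ^ 3" using kw wpos by (intro mult_right_mono) auto
  ultimately show False using nonneg
    by (simp add: power2_eq_square power3_eq_cube algebra_simps)
qed

lemma isCont_vol: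
  assumes "isCont T s" "isCont C s" "0 < C s" "C s < 2 * pi"
  shows "isCont (\<lambda>s. vol (T s) (C s)) s"
proof -
  have "1 - cos (T s / 2) * cos (C s / 2) > 0" using assms by (intro one_minus_cos_cos_pos) auto
  then show ?thesis unfolding vol_half_angles vol_h_def
    by (intro continuous_intros assms) auto
qed

text \<open>
  Jensen's inequality, extended to points on the upper boundary of \<open>region_D\<close>, which the region
  does not contain. The diagonal lies strictly below that boundary, so moving every point a
  fraction \<open>\<epsilon>\<close> of its way down to the diagonal brings it into the region; then \<open>\<epsilon>\<close> tends to \<open>0\<close>.
\<close>

lemma sum_vol_le_vol_mean:
  fixes \<tau> c :: "'i \<Rightarrow> real"
  assumes sep: "separating_function \<phi>" and I: "finite I" "I \<noteq> {}"
    and \<tau>: "\<And>i. i \<in> I \<Longrightarrow> 0 < \<tau> i \<and> \<tau> i < pi / 2"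
    and c: "\<And>i. i \<in> I \<Longrightarrow> \<tau> i \<le> c i \<and> c i \<le> min (\<phi> (\<tau> i)) c_max"
  shows "(\<Sum>i\<in>I. vol (\<tau> i) (c i)) \<le> card I * vol ((\<Sum>i\<in>I. \<tau> i) / card I) ((\<Sum>i\<in>I. c i) / card I)"
proof -
  define n where "n = real (card I)"
  have n: "n > 0" using I by (simp add: n_def card_gt_0_iff)
  \<comment> \<open>The points moved towards the diagonal.\<close>
  define d where "d = (\<lambda>\<epsilon> i. (1 - \<epsilon>) * c i + \<epsilon> * \<tau> i)"
  define g where "g = (\<lambda>\<epsilon>. n * vol ((\<Sum>i\<in>I. \<tau> i) / n) ((\<Sum>i\<in>I. d \<epsilon> i) / n) - (\<Sum>i\<in>I. vol (\<tau> i) (d \<epsilon> i)))"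
  have conc: "concave_on (region_D \<phi>) (\<lambda>(\<tau>, c). vol \<tau> c)"
    using sep by (simp add: separating_function_def)
  have g: "0 \<le> g \<epsilon>" if \<epsilon>: "0 < \<epsilon>" "\<epsilon> < 1" for \<epsilon>
  proof -
    have mem: "(\<tau> i, d \<epsilon> i) \<in> region_D \<phi>" if i: "i \<in> I" for i
    proof -
      define m where "m = min (\<phi> (\<tau> i)) c_max"
      have "\<tau> i < \<phi> (\<tau> i)"
        using \<tau>[OF i] c[OF i] by (intro separating_function_above_diagonal[OF sep]) auto
      then have m: "\<tau> i < m" using \<tau>[OF i] c_max_bounds by (simp add: m_def)
      have "d \<epsilon> i < (1 - \<epsilon>) * m + \<epsilon> * m"
        unfolding d_def using c[OF i] m \<epsilon> m_def by (intro add_le_less_mono mult_left_mono mult_strict_left_mono) auto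
      also have "\<dots> = m" by (simp add: algebra_simps)
      finally have "d \<epsilon> i < m" .
      moreover have "\<tau> i \<le> d \<epsilon> i"
        using mult_left_mono[of "\<tau> i" "c i" "1 - \<epsilon>"] c[OF i] \<epsilon> by (simp add: d_def algebra_simps)
      ultimately show ?thesis using \<tau>[OF i] by (simp add: region_D_def m_def)
    qed
    have "(\<Sum>i\<in>I. 1 / n * (case (\<tau> i, d \<epsilon> i) of (\<tau>, c) \<Rightarrow> vol \<tau> c))
        \<le> (case \<Sum>i\<in>I. (1 / n) *\<^sub>R (\<tau> i, d \<epsilon> i) of (\<tau>, c) \<Rightarrow> vol \<tau> c)"
      using n by (intro concave_on_sum[OF I conc] mem) (auto simp: n_def)
    also have "(\<Sum>i\<in>I. (1 / n) *\<^sub>R (\<tau> i, d \<epsilon> i)) = ((\<Sum>i\<in>I. \<tau> i) / n, (\<Sum>i\<in>I. d \<epsilon> i) / n)"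
      by (simp add: sum_prod sum_divide_distrib)
    finally have "(\<Sum>i\<in>I. vol (\<tau> i) (d \<epsilon> i)) / n \<le> vol ((\<Sum>i\<in>I. \<tau> i) / n) ((\<Sum>i\<in>I. d \<epsilon> i) / n)"
      by (simp add: sum_divide_distrib)
    then show ?thesis using n by (simp add: g_def field_simps)
  qed
  have d0: "d 0 i = c i" for i by (simp add: d_def)
  have cb: "0 < c i" "c i < pi" if "i \<in> I" for i using \<tau>[OF that] c[OF that] c_max_bounds by auto
  have "0 < (\<Sum>i\<in>I. c i)" using I cb by (intro sum_pos) auto
  moreover have "(\<Sum>i\<in>I. c i) < n * (2 * pi)"
    using sum_strict_mono[OF I, of c "\<lambda>_. 2 * pi"] cb pi_gt_zero by (force simp: n_def)
  ultimately have mean: "0 < (\<Sum>i\<in>I. c i) / n" "(\<Sum>i\<in>I. c i) / n < 2 * pi"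
    using n by (simp_all add: field_simps)
  have cd: "isCont (\<lambda>\<epsilon>. d \<epsilon> i) 0" for i unfolding d_def by (intro continuous_intros)
  have "isCont (\<lambda>\<epsilon>. vol ((\<Sum>i\<in>I. \<tau> i) / n) ((\<Sum>i\<in>I. d \<epsilon> i) / n)) 0"
    by (intro isCont_vol continuous_intros cd) (use mean n in \<open>simp_all add: d0\<close>)
  moreover have "isCont (\<lambda>\<epsilon>. vol (\<tau> i) (d \<epsilon> i)) 0" if "i \<in> I" for i
    using cb[OF that] pi_gt_zero by (intro isCont_vol continuous_intros cd) (simp_all add: d0)
  ultimately have "isCont g 0"
    unfolding g_def by (intro continuous_diff continuous_mult_left continuous_sum) auto
  then have "(g \<longlongrightarrow> g 0) (at_right 0)"
    unfolding isCont_def by (rule tendsto_mono[OF at_le, rotated]) simp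
  moreover have "\<forall>\<^sub>F \<epsilon> in at_right 0. 0 \<le> g \<epsilon>"
    unfolding eventually_at_right_field using g by (intro exI[of _ 1]) auto
  ultimately have "0 \<le> g 0" by (rule tendsto_lowerbound) simp
  then show ?thesis by (simp add: g_def d0 n_def)
qed

section \<open>Cones over triangles\<close>

definition tri_cone :: "real ^ 3 \<Rightarrow> real ^ 3 \<Rightarrow> real ^ 3 \<Rightarrow> (real ^ 3) set" where
  "tri_cone A B C = {v. 0 \<le> cross3 B C \<bullet> v} \<inter> {v. 0 \<le> cross3 C A \<bullet> v} \<inter> {v. 0 \<le> cross3 A B \<bullet> v}"

lemma closed_tri_cone: "closed (tri_cone A B C)"
proof -
  have "closed {v. 0 \<le> n \<bullet> v}" for n :: "real ^ 3" using closed_halfspace_ge[of 0 n] by simp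
  then show ?thesis unfolding tri_cone_def by (intro closed_Int)
qed

text \<open>
  \<open>N\<close> is a normal of the plane of the triangle, scaled so that the plane lies at height
  \<open>A \<bullet> cross3 B C\<close>; inside the cone over the triangle, the plane cuts out exactly the triangle.
\<close>

lemma mem_triangle_iff:
  fixes A B C :: "real ^ 3"
  assumes D: "A \<bullet> cross3 B C > 0"
  defines "N \<equiv> cross3 B C + cross3 C A + cross3 A B"
  shows "y \<in> convex hull {A, B, C} \<longleftrightarrow> y \<in> tri_cone A B C \<and> N \<bullet> y = A \<bullet> cross3 B C"
proof -
  let ?D = "A \<bullet> cross3 B C"
  have dots: "cross3 B C \<bullet> A = ?D" "cross3 B C \<bullet> B = 0" "cross3 B C \<bullet> C = 0"
    "cross3 C A \<bullet> A = 0" "cross3 C A \<bullet> B = ?D" "cross3 C A \<bullet> C = 0"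
    "cross3 A B \<bullet> A = 0" "cross3 A B \<bullet> B = 0" "cross3 A B \<bullet> C = ?D"
    by (simp_all only: dot_cross_self triple_product_rotate inner_commute[of "cross3 B C" A]
        inner_commute[of "cross3 C A" B] inner_commute[of "cross3 A B" C])
  show ?thesis
  proof
    assume "y \<in> convex hull {A, B, C}"
    then obtain p q r where "y = p *\<^sub>R A + q *\<^sub>R B + r *\<^sub>R C" "0 \<le> p" "0 \<le> q" "0 \<le> r" "p + q + r = 1"
      unfolding convex_hull_3 by blast
    note y = this
    have "N \<bullet> y = (p + q + r) * ?D" unfolding y(1)
      by (simp add: N_def inner_add_left inner_add_right dots distrib_right)
    then have "N \<bullet> y = ?D" by (simp only: y(5) mult_1)
    moreover have "y \<in> tri_cone A B C"
      using D y(2-4) unfolding y(1) by (simp add: tri_cone_def inner_add_right dots)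
    ultimately show "y \<in> tri_cone A B C \<and> N \<bullet> y = ?D" by blast
  next
    assume y: "y \<in> tri_cone A B C \<and> N \<bullet> y = ?D"
    define p q r where "p = cross3 B C \<bullet> y / ?D" and "q = cross3 C A \<bullet> y / ?D" and "r = cross3 A B \<bullet> y / ?D"
    have "p + q + r = 1"
      using y D by (simp add: p_def q_def r_def N_def inner_add_left flip: add_divide_distrib)
    moreover have "0 \<le> p" "0 \<le> q" "0 \<le> r" using y D by (auto simp: p_def q_def r_def tri_cone_def)
    moreover have "y = p *\<^sub>R A + q *\<^sub>R B + r *\<^sub>R C"
      using arg_cong[OF scaleR_triple_product_expansion[of A B C y], of "\<lambda>x. x /\<^sub>R ?D"] D
      by (simp add: scaleR_add_right p_def q_def r_def divide_inverse mult.commute)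
    ultimately show "y \<in> convex hull {A, B, C}" unfolding convex_hull_3 by blast
  qed
qed

lemma tri_cone_normal_pos:
  fixes A B C :: "real ^ 3"
  assumes D: "A \<bullet> cross3 B C > 0" and v: "v \<in> tri_cone A B C" "v \<noteq> 0"
  shows "(cross3 B C + cross3 C A + cross3 A B) \<bullet> v > 0"
proof (rule ccontr)
  assume "\<not> ?thesis"
  then have "cross3 B C \<bullet> v = 0" "cross3 C A \<bullet> v = 0" "cross3 A B \<bullet> v = 0"
    using v by (auto simp: tri_cone_def inner_add_left)
  then have "(A \<bullet> cross3 B C) *\<^sub>R v = 0" unfolding scaleR_triple_product_expansion[of A B C v] by simp
  then show False using D v by simp
qed

lemma tri_cone_scaleR: "0 < s \<Longrightarrow> s *\<^sub>R v \<in> tri_cone A B C \<longleftrightarrow> v \<in> tri_cone A B C"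
  by (simp add: tri_cone_def zero_le_mult_iff)

lemma tri_cone_scale_to_triangle:
  fixes A B C :: "real ^ 3"
  assumes D: "A \<bullet> cross3 B C > 0" and v: "v \<in> tri_cone A B C" "v \<noteq> 0"
  obtains s where "s > 0" "s *\<^sub>R v \<in> convex hull {A, B, C}"
proof
  let ?N = "cross3 B C + cross3 C A + cross3 A B"
  have pos: "?N \<bullet> v > 0" by (rule tri_cone_normal_pos[OF D v])
  then show s: "(A \<bullet> cross3 B C) / (?N \<bullet> v) > 0" using D by simp
  show "((A \<bullet> cross3 B C) / (?N \<bullet> v)) *\<^sub>R v \<in> convex hull {A, B, C}"
    unfolding mem_triangle_iff[OF D] tri_cone_scaleR[OF s] using v pos by simp
qed

text \<open>
  The cone of height one over the projected triangle, whose volume defines the spherical area, is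
  the part of the unit ball in the infinite cone over the triangle.
\<close>

lemma spherical_area_triangle:
  fixes A B C :: "real ^ 3"
  assumes D: "A \<bullet> cross3 B C > 0"
  shows "spherical_area (central_projection (convex hull {A, B, C}))
    = 3 * measure lebesgue (cball 0 1 \<inter> tri_cone A B C)"
proof -
  let ?T = "convex hull {A, B, C}"
  have "{t *\<^sub>R x | t x. 0 \<le> t \<and> t \<le> 1 \<and> x \<in> central_projection ?T} = cball 0 1 \<inter> tri_cone A B C"
  proof (intro equalityI subsetI)
    fix v assume "v \<in> {t *\<^sub>R x | t x. 0 \<le> t \<and> t \<le> 1 \<and> x \<in> central_projection ?T}"
    then obtain t y where v: "v = t *\<^sub>R (y /\<^sub>R norm y)" "0 \<le> t" "t \<le> 1" "y \<in> ?T" "y \<noteq> 0"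
      unfolding central_projection_def by blast
    then have y: "y \<in> tri_cone A B C" using mem_triangle_iff[OF D] by blast
    have "v \<in> tri_cone A B C"
    proof (cases "t = 0")
      case True then show ?thesis using v by (simp add: tri_cone_def)
    next
      case False
      then have "v = (t / norm y) *\<^sub>R y" "t / norm y > 0" using v by (auto simp: divide_inverse)
      then show ?thesis using y by (simp only: tri_cone_scaleR)
    qed
    moreover have "norm (y /\<^sub>R norm y) = 1" using v(5) by simp
    then have "norm v = t" unfolding v(1) norm_scaleR using v(2) by simp
    ultimately show "v \<in> cball 0 1 \<inter> tri_cone A B C" using v(3) by simp
  next
    fix v assume v: "v \<in> cball 0 1 \<inter> tri_cone A B C"
    show "v \<in> {t *\<^sub>R x | t x. 0 \<le> t \<and> t \<le> 1 \<and> x \<in> central_projection ?T}"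
    proof (cases "v = 0")
      case True
      have "A \<in> ?T" "A \<noteq> 0" using D by (auto intro: hull_inc)
      then have "A /\<^sub>R norm A \<in> central_projection ?T" by (auto simp: central_projection_def)
      then show ?thesis unfolding True by (intro CollectI exI[of _ 0] exI[of _ "A /\<^sub>R norm A"]) simp
    next
      case False
      obtain s where s: "s > 0" "s *\<^sub>R v \<in> ?T" using tri_cone_scale_to_triangle[OF D _ False] v by auto
      have "v /\<^sub>R norm v = (s *\<^sub>R v) /\<^sub>R norm (s *\<^sub>R v)" using s by simp
      moreover have "s *\<^sub>R v \<in> ?T - {0}" using s False by simp
      ultimately have "v /\<^sub>R norm v \<in> central_projection ?T" unfolding central_projection_def by blast
      moreover have "v = norm v *\<^sub>R (v /\<^sub>R norm v)" using False by simp
      ultimately show ?thesis using v by (intro CollectI exI[of _ "norm v"] exI[of _ "v /\<^sub>R norm v"]) simp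
    qed
  qed
  then show ?thesis by (simp add: spherical_area_def)
qed

lemma spherical_area_hyperplane:
  fixes S :: "(real ^ 3) set"
  assumes "n \<noteq> 0" "\<And>x. x \<in> S \<Longrightarrow> n \<bullet> x = 0"
  shows "spherical_area (central_projection S) = 0"
proof -
  have "negligible {t *\<^sub>R x | t x. 0 \<le> t \<and> t \<le> 1 \<and> x \<in> central_projection S}"
    by (rule negligible_subset[OF negligible_hyperplane[of n 0]])
       (use assms in \<open>auto simp: central_projection_def\<close>)
  then show ?thesis by (simp add: spherical_area_def negligible_imp_measure0)
qed

text \<open>
  A triangle whose plane contains the origin projects into a great circle. Two of the vertices
  may be antipodal, so the normal of the plane has to be found from a suitable pair of vertices.
\<close>

lemma spherical_area_coplanar:
  fixes A B C :: "real ^ 3"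
  assumes u: "norm A = 1" "norm B = 1" "norm C = 1" and dist: "A \<noteq> B" "A \<noteq> C" "B \<noteq> C"
    and D: "A \<bullet> cross3 B C = 0"
  shows "spherical_area (central_projection (convex hull {A, B, C})) = 0"
proof -
  have par: "Q = P \<or> Q = - P" if "norm P = 1" "norm Q = 1" "cross3 P Q = 0" for P Q :: "real ^ 3"
  proof -
    have "(P \<bullet> Q)\<^sup>2 = 1" using norm_cross_dot[of P Q] that by simp
    then have "P \<bullet> Q = 1 \<or> P \<bullet> Q = - 1" by (simp add: power2_eq_1_iff)
    moreover have "(norm (Q - P))\<^sup>2 = 2 - 2 * (P \<bullet> Q)" "(norm (Q + P))\<^sup>2 = 2 + 2 * (P \<bullet> Q)"
      using that by (simp_all add: power2_norm_eq_inner inner_diff_left inner_diff_right inner_add_left inner_add_right norm_eq_1 inner_commute)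
    ultimately have "norm (Q - P) = 0 \<or> norm (Q + P) = 0" by auto
    then show ?thesis by (auto simp: eq_neg_iff_add_eq_0)
  qed
  obtain n where n: "n \<noteq> 0" "n \<bullet> A = 0" "n \<bullet> B = 0" "n \<bullet> C = 0"
  proof (cases "cross3 A B = 0")
    case False
    show ?thesis
      by (rule that[OF False])
        (simp_all only: dot_cross_self inner_commute[of "cross3 A B" C] triple_product_rotate(2)[of C A B] D)
  next
    case True
    then have B: "B = - A" using par[of A B] u dist by auto
    then have "C \<noteq> - A" using dist by auto
    then have "cross3 A C \<noteq> 0" using par[of A C] u dist by auto
    then show ?thesis by (rule that) (simp_all add: B dot_cross_self)
  qed
  have "n \<bullet> x = 0" if "x \<in> convex hull {A, B, C}" for x
    using that n unfolding convex_hull_3 by (auto simp: inner_add_right)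
  with n(1) show ?thesis by (rule spherical_area_hyperplane)
qed

lemma measure_tetrahedron_at_origin:
  fixes A B C :: "real ^ 3"
  assumes D: "A \<bullet> cross3 B C > 0"
  shows "measure lebesgue (convex hull {0, A, B, C}) = (A \<bullet> cross3 B C) / 6"
proof -
  have nz: "A \<noteq> 0" "B \<noteq> 0" "C \<noteq> 0" using D by auto
  have ne: "A \<noteq> B" "A \<noteq> C" "B \<noteq> C" using D by (auto simp: dot_cross_self)
  define f :: "3 \<Rightarrow> real ^ 3" where "f = (\<lambda>i. if i = 1 then A else if i = 2 then B else C)"
  have f: "f 1 = A" "f 2 = B" "f 3 = C" by (simp_all add: f_def)
  have inj: "inj f" using ne unfolding inj_def forall_3 f by auto
  have "range f = {A, B, C}" unfolding UNIV_3 by (simp add: f insert_commute)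
  then have bij: "bij_betw f UNIV ({0, A, B, C} - {0})" using inj nz by (auto simp: bij_betw_def)
  have card: "card {0, A, B, C} = Suc CARD(3)" using nz ne by auto
  have "measure lebesgue (convex hull {0, A, B, C}) = measure lborel (convex hull {0, A, B, C})"
    by (intro measure_completion) (auto intro!: borel_compact finite_imp_compact_convex_hull)
  also have "\<dots> = \<bar>det (\<chi> i j. f j $ i - 0 $ i)\<bar> / fact CARD(3)"
    by (rule content_simplex[OF _ card _ bij]) auto
  also have "det (\<chi> i j. f j $ i - 0 $ i) = A \<bullet> cross3 B C"
    by (simp add: cross3_simps f)
  finally show ?thesis using D by (simp add: fact_numeral)
qed

section \<open>Star-shaped polyhedra with triangular faces\<close>

lemma triangle_rel_interior:
  fixes A B C :: "real ^ 3"
  assumes D: "A \<bullet> cross3 B C > 0" and y: "y \<in> convex hull {A, B, C}"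
    and pos: "0 < cross3 B C \<bullet> y" "0 < cross3 C A \<bullet> y" "0 < cross3 A B \<bullet> y"
  shows "y \<in> rel_interior (convex hull {A, B, C})"
proof -
  let ?D = "A \<bullet> cross3 B C"
  have ne: "A \<noteq> B" "A \<noteq> C" "B \<noteq> C" using D by (auto simp: dot_cross_self)
  define u where "u = (\<lambda>x. (if x = A then cross3 B C else if x = B then cross3 C A else cross3 A B) \<bullet> y / ?D)"
  have u: "u A = cross3 B C \<bullet> y / ?D" "u B = cross3 C A \<bullet> y / ?D" "u C = cross3 A B \<bullet> y / ?D"
    using ne by (auto simp: u_def)
  have "sum u {A, B, C} = 1"
    using y D ne unfolding mem_triangle_iff[OF D]
    by (simp add: u inner_add_left add.assoc flip: add_divide_distrib)
  moreover have "(\<Sum>x\<in>{A, B, C}. u x *\<^sub>R x) = y"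
    using arg_cong[OF scaleR_triple_product_expansion[of A B C y], of "\<lambda>x. x /\<^sub>R ?D"] D ne
    by (simp add: scaleR_add_right u divide_inverse mult.commute add.assoc)
  moreover have "\<forall>x\<in>{A, B, C}. 0 < u x" using pos D by (simp add: u)
  ultimately show ?thesis
    using explicit_subset_rel_interior_convex_hull_minimal[of "{A, B, C}"] by blast
qed

text \<open>
  Suppose \<open>P\<close> contained a point beyond \<open>y\<close> on the ray through \<open>y\<close>. By star-shapedness the segment
  through \<open>y\<close> then meets \<open>P\<close> on both sides of the plane that carries the frontier near \<open>y\<close>. Both
  half balls around \<open>y\<close> are connected and avoid the frontier, so both lie in \<open>P\<close>, and so does the
  whole ball because \<open>P\<close> is closed. That makes \<open>y\<close> an interior point.
\<close>

lemma star_shaped_leaves_at_flat_frontier: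
  fixes P :: "'a::euclidean_space set"
  assumes "closed P" and star: "star_shaped_wrt 0 P" and y: "y \<in> frontier P"
    and h: "0 < h" "n \<bullet> y = h" and r: "0 < r"
    and flat: "\<And>z. z \<in> ball y r \<Longrightarrow> z \<in> frontier P \<Longrightarrow> n \<bullet> z = h"
    and t: "1 < t"
  shows "t *\<^sub>R y \<notin> P"
proof
  assume tP: "t *\<^sub>R y \<in> P"
  have seg: "s *\<^sub>R y \<in> P" if "0 \<le> s" "s \<le> t" for s
  proof -
    have "s *\<^sub>R y = (1 - s / t) *\<^sub>R 0 + (s / t) *\<^sub>R (t *\<^sub>R y)" using t by simp
    moreover have "0 \<le> s / t" "s / t \<le> 1" using that t by auto
    ultimately have "s *\<^sub>R y \<in> closed_segment 0 (t *\<^sub>R y)" unfolding in_segment by blast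
    then show ?thesis using star tP by (auto simp: star_shaped_wrt_def)
  qed
  have ny: "norm y > 0" using h by auto
  \<comment> \<open>Small enough for \<open>(1 + \<epsilon>) *\<^sub>R y\<close> to stay in the ball and on the segment up to \<open>t *\<^sub>R y\<close>.\<close>
  define \<epsilon> where "\<epsilon> = min (min (t - 1) (1 / 2)) (r / (2 * norm y))"
  have \<epsilon>: "0 < \<epsilon>" "1 + \<epsilon> \<le> t" "\<epsilon> < 1" using t r ny by (auto simp: \<epsilon>_def)
  have "\<epsilon> * norm y \<le> r / (2 * norm y) * norm y" using ny by (intro mult_right_mono) (auto simp: \<epsilon>_def)
  then have small: "\<epsilon> * norm y < r" using ny r by simp
  have side: "ball y r \<inter> H \<subseteq> P" if "convex H" "H \<inter> {z. n \<bullet> z = h} = {}" "x \<in> ball y r \<inter> H" "x \<in> P" for H x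
  proof (rule ccontr)
    assume "\<not> ?thesis"
    then have "(ball y r \<inter> H) \<inter> frontier P \<noteq> {}"
      using that by (intro connected_Int_frontier convex_connected convex_Int convex_ball) auto
    then show False using flat that(2) by blast
  qed
  have up: "ball y r \<inter> {z. h < n \<bullet> z} \<subseteq> P"
  proof (rule side)
    have "(1 + \<epsilon>) *\<^sub>R y - y = \<epsilon> *\<^sub>R y" by (simp add: scaleR_add_left)
    then show "(1 + \<epsilon>) *\<^sub>R y \<in> ball y r \<inter> {z. h < n \<bullet> z}"
      using small \<epsilon> h by (simp add: dist_norm norm_minus_commute[of y])
    show "(1 + \<epsilon>) *\<^sub>R y \<in> P" using \<epsilon> by (intro seg) auto
  qed (use convex_halfspace_gt[of h n] in auto)
  have down: "ball y r \<inter> {z. n \<bullet> z < h} \<subseteq> P"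
  proof (rule side)
    have "y - (1 - \<epsilon>) *\<^sub>R y = \<epsilon> *\<^sub>R y" by (simp add: scaleR_diff_left)
    then show "(1 - \<epsilon>) *\<^sub>R y \<in> ball y r \<inter> {z. n \<bullet> z < h}"
      using small \<epsilon> h by (simp add: dist_norm)
    show "(1 - \<epsilon>) *\<^sub>R y \<in> P" using \<epsilon> t by (intro seg) auto
  qed (use convex_halfspace_lt[of n h] in auto)
  have "ball y r \<subseteq> P"
  proof
    fix z assume z: "z \<in> ball y r"
    show "z \<in> P"
    proof (cases "n \<bullet> z = h")
      case False then show ?thesis using up down z by (auto simp: neq_iff)
    next
      case True
      have lim: "((\<lambda>s. (1 + s) *\<^sub>R z) \<longlongrightarrow> (1 + 0) *\<^sub>R z) (at_right 0)" by (intro tendsto_intros)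
      have "\<forall>\<^sub>F s in at_right 0. (1 + s) *\<^sub>R z \<in> ball y r"
        using topological_tendstoD[OF lim open_ball] z by simp
      moreover have "\<forall>\<^sub>F s :: real in at_right 0. 0 < s" by (simp add: eventually_at_right_less)
      ultimately have "\<forall>\<^sub>F s in at_right 0. (1 + s) *\<^sub>R z \<in> P"
      proof eventually_elim
        case (elim s)
        then have "(1 + s) *\<^sub>R z \<in> ball y r \<inter> {z. h < n \<bullet> z}" using True h by simp
        then show ?case using up by blast
      qed
      from Lim_in_closed_set[OF \<open>closed P\<close> this _ lim] show ?thesis by simp
    qed
  qed
  then have "y \<in> interior P" using r by (meson centre_in_ball interior_maximal open_ball subsetD)
  then show False using y by (simp add: frontier_def)
qed

text \<open>
  The vertices of each face are listed so that their triple product is positive. In particular no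
  face lies in a plane through the origin.
\<close>

locale star_polyhedron =
  fixes P :: "(real ^ 3) set" and I :: "'i set" and A B C :: "'i \<Rightarrow> real ^ 3"
  assumes fin: "finite I" and comp: "compact P" and star: "star_shaped_wrt 0 P"
    and orient: "\<And>i. i \<in> I \<Longrightarrow> 0 < A i \<bullet> cross3 (B i) (C i)"
    and simplex: "\<And>i. i \<in> I \<Longrightarrow> 2 simplex convex hull {A i, B i, C i}"
    and inj: "inj_on (\<lambda>i. convex hull {A i, B i, C i}) I"
    and faces: "triangulation ((\<lambda>i. convex hull {A i, B i, C i}) ` I)"
    and frontier: "frontier P = (\<Union>i\<in>I. convex hull {A i, B i, C i})"
begin

abbreviation face where "face i \<equiv> convex hull {A i, B i, C i}"
abbreviation cone where "cone i \<equiv> tri_cone (A i) (B i) (C i)"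

definition open_cone where
  "open_cone i = {v. 0 < cross3 (B i) (C i) \<bullet> v \<and> 0 < cross3 (C i) (A i) \<bullet> v \<and> 0 < cross3 (A i) (B i) \<bullet> v}"

definition walls where
  "walls i = {v. cross3 (B i) (C i) \<bullet> v = 0} \<union> {v. cross3 (C i) (A i) \<bullet> v = 0} \<union> {v. cross3 (A i) (B i) \<bullet> v = 0}"

lemma negligible_walls: "i \<in> I \<Longrightarrow> negligible (walls i)"
proof -
  assume i: "i \<in> I"
  have "cross3 (B i) (C i) \<noteq> 0" "cross3 (C i) (A i) \<noteq> 0" "cross3 (A i) (B i) \<noteq> 0"
    using orient[OF i] triple_product_rotate[where A="A i" and B="B i" and C="C i"]
    by (metis inner_zero_right less_irrefl)+
  then show ?thesis unfolding walls_def by (intro negligible_Un negligible_hyperplane) auto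
qed

lemma cone_diff_walls: "cone i - walls i = open_cone i"
  by (auto simp: tri_cone_def walls_def open_cone_def)

lemma open_cone_subset: "open_cone i \<subseteq> cone i"
  by (auto simp: tri_cone_def open_cone_def)

lemma open_cone_scaleR: "0 < s \<Longrightarrow> s *\<^sub>R v \<in> open_cone i \<longleftrightarrow> v \<in> open_cone i"
  by (simp add: open_cone_def zero_less_mult_iff)

text \<open>
  Two faces meet in a common face of both. If it contains a relative interior point of the first
  triangle, it is all of that triangle; a proper face of the second has smaller dimension, so the
  two triangles coincide.
\<close>

lemma face_eq_if_meets_interior:
  assumes i: "i \<in> I" "y \<in> face i" "y \<in> open_cone i" and j: "j \<in> I" "y \<in> face j"
  shows "j = i"
proof -
  have face: "face i \<inter> face j face_of face i" "face j \<inter> face i face_of face j"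
    using faces i(1) j(1) unfolding triangulation_def by blast+
  have "y \<in> rel_interior (face i)"
    using i orient by (intro triangle_rel_interior) (auto simp: open_cone_def)
  then have "face i \<subseteq> face i \<inter> face j"
    using subset_of_face_of[OF face(1), of "face i"] i j by blast
  then have "face i face_of face j" using face(2) by (simp add: inf.absorb2)
  then have "face i = face j"
    using face_of_aff_dim_lt[of "face j" "face i"] aff_dim_simplex[OF simplex] i(1) j(1) by force
  then show ?thesis using inj i(1) j(1) by (auto simp: inj_on_def)
qed

lemma face_subset_frontier: "i \<in> I \<Longrightarrow> face i \<subseteq> frontier P"
  unfolding frontier by blast

lemma face_subset: "i \<in> I \<Longrightarrow> face i \<subseteq> P"
  using face_subset_frontier frontier_subset_closed[OF compact_imp_closed[OF comp]] by (rule order_trans)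

lemma beyond_face_interior:
  assumes i: "i \<in> I" "y \<in> face i" "y \<in> open_cone i" and t: "1 < t"
  shows "t *\<^sub>R y \<notin> P"
proof -
  define N where "N = cross3 (B i) (C i) + cross3 (C i) (A i) + cross3 (A i) (B i)"
  let ?h = "A i \<bullet> cross3 (B i) (C i)"
  have face_plane: "N \<bullet> z = ?h" if "z \<in> face i" for z
    using that mem_triangle_iff[OF orient[OF i(1)]] by (simp add: N_def)
  let ?O = "- (\<Union>j\<in>I - {i}. face j)"
  have "closed (\<Union>j\<in>I - {i}. face j)"
    using fin by (intro closed_UN finite_Diff) (auto intro!: compact_imp_closed finite_imp_compact_convex_hull)
  then have "open ?O" by (rule open_Compl)
  moreover have "y \<in> ?O" using face_eq_if_meets_interior[OF i] by auto
  ultimately obtain r where r: "r > 0" "ball y r \<subseteq> ?O" using openE by blast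
  show ?thesis
  proof (rule star_shaped_leaves_at_flat_frontier[OF _ star _ _ _ r(1)])
    show "y \<in> frontier P" using face_subset_frontier i by blast
    show "N \<bullet> z = ?h" if "z \<in> ball y r" "z \<in> frontier P" for z
      using that r(2) face_plane unfolding frontier by blast
  qed (use comp compact_imp_closed orient i face_plane t in auto)
qed

text \<open>
  Consider a ray in both open cones. Beyond the first of the two faces that it meets, it has left
  \<open>P\<close>, so it meets both faces in the same point, and that point lies in the interior of a face.
\<close>

lemma open_cones_disjoint:
  assumes i: "i \<in> I" and j: "j \<in> I" and v: "v \<in> open_cone i" "v \<in> open_cone j"
  shows "i = j"
proof -
  have vK: "v \<in> cone i" "v \<in> cone j" using v open_cone_subset by auto
  have v0: "v \<noteq> 0" using v(1) by (auto simp: open_cone_def)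
  obtain s where s: "s > 0" "s *\<^sub>R v \<in> face i" using tri_cone_scale_to_triangle[OF orient[OF i] vK(1) v0] .
  obtain s' where s': "s' > 0" "s' *\<^sub>R v \<in> face j" using tri_cone_scale_to_triangle[OF orient[OF j] vK(2) v0] .
  have le: "q \<le> p" if "k \<in> I" "l \<in> I" "v \<in> open_cone k" "0 < p" "p *\<^sub>R v \<in> face k" "q *\<^sub>R v \<in> face l" for k l p q
  proof (rule ccontr)
    assume "\<not> q \<le> p"
    then have "1 < q / p" using that by simp
    then have "(q / p) *\<^sub>R (p *\<^sub>R v) \<notin> P"
      using that by (intro beyond_face_interior) (auto simp: open_cone_scaleR)
    moreover have "(q / p) *\<^sub>R (p *\<^sub>R v) = q *\<^sub>R v" using that by simp
    ultimately show False using that face_subset by auto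
  qed
  have "s' = s" using le[OF i j v(1) s s'(2)] le[OF j i v(2) s' s(2)] by simp
  then show ?thesis
    using face_eq_if_meets_interior[of j "s *\<^sub>R v" i] i j s s' v by (simp add: open_cone_scaleR)
qed

lemma cones_meet_negligibly:
  assumes "i \<in> I" "j \<in> I" "i \<noteq> j"
  shows "negligible (cone i \<inter> cone j)"
proof (rule negligible_subset)
  show "negligible (walls i \<union> walls j)" using assms by (intro negligible_Un negligible_walls)
  show "cone i \<inter> cone j \<subseteq> walls i \<union> walls j"
    using open_cones_disjoint[of i j] assms unfolding set_eq_iff cone_diff_walls[symmetric] by blast
qed

lemma zero_in_interior: "0 \<in> interior P"
proof -
  have "0 \<notin> face i" if "i \<in> I" for i
  proof
    assume "0 \<in> face i"
    then have "(cross3 (B i) (C i) + cross3 (C i) (A i) + cross3 (A i) (B i)) \<bullet> 0 = A i \<bullet> cross3 (B i) (C i)"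
      using mem_triangle_iff[OF orient[OF that]] by blast
    then show False using orient[OF that] by simp
  qed
  then have "0 \<notin> frontier P" unfolding frontier by blast
  moreover have "0 \<in> P" using star by (simp add: star_shaped_wrt_def)
  ultimately show ?thesis using closure_subset by (auto simp: frontier_def)
qed

text \<open>
  The origin is an interior point, as no face contains it; so every ray from it reaches the
  frontier.
\<close>

lemma cones_cover:
  assumes "v \<noteq> 0"
  shows "\<exists>i\<in>I. v \<in> cone i"
proof -
  obtain d where d: "0 < d" "0 + d *\<^sub>R v \<in> frontier P"
    by (rule ray_to_frontier[OF compact_imp_bounded[OF comp] zero_in_interior assms], rule that)
  then obtain i where i: "i \<in> I" "d *\<^sub>R v \<in> face i" unfolding frontier by auto
  then have "d *\<^sub>R v \<in> cone i" using mem_triangle_iff[OF orient] by blast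
  then show ?thesis using i(1) d(1) by (auto simp: tri_cone_scaleR)
qed

lemma index_nonempty: "I \<noteq> {}"
proof
  assume "I = {}"
  then show False using cones_cover[OF zero_neq_one[symmetric]] by simp
qed

theorem sum_spherical_area: "(\<Sum>i\<in>I. spherical_area (central_projection (face i))) = 4 * pi"
proof -
  let ?S = "\<lambda>i. cball 0 1 \<inter> cone i"
  have "(\<Union>i\<in>I. ?S i) = cball 0 1"
  proof
    show "(\<Union>i\<in>I. ?S i) \<subseteq> cball 0 1" by blast
    show "cball 0 1 \<subseteq> (\<Union>i\<in>I. ?S i)"
    proof
      fix v :: "real ^ 3" assume v: "v \<in> cball 0 1"
      have "\<exists>i\<in>I. v \<in> cone i"
      proof (cases "v = 0")
        case True
        then have "v \<in> cone i" for i by (simp add: tri_cone_def)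
        then show ?thesis using index_nonempty by blast
      qed (rule cones_cover)
      then show "v \<in> (\<Union>i\<in>I. ?S i)" using v by blast
    qed
  qed
  then have "measure lebesgue (cball 0 1 :: (real ^ 3) set) = measure lebesgue (\<Union>i\<in>I. ?S i)" by simp
  also have "\<dots> = (\<Sum>i\<in>I. measure lebesgue (?S i))"
  proof (rule measure_negligible_finite_Union_image[OF fin])
    show "?S i \<in> lmeasurable" for i
      by (intro lmeasurable_compact compact_Int_closed compact_cball closed_tri_cone)
    show "pairwise (\<lambda>i j. negligible (?S i \<inter> ?S j)) I"
      unfolding pairwise_def using cones_meet_negligibly by (blast intro: negligible_subset)
  qed
  finally have "(\<Sum>i\<in>I. 3 * measure lebesgue (?S i)) = 3 * measure lebesgue (cball 0 1 :: (real ^ 3) set)"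
    by (simp flip: sum_distrib_left)
  also have "\<dots> = 4 * pi" by (simp add: content_cball unit_ball_vol_3)
  finally show ?thesis by (simp add: spherical_area_triangle orient)
qed

text \<open>
  A point of \<open>P\<close> in the open cone over a face lies before the face, because the ray through it does
  not return to \<open>P\<close> behind the face; so it lies in the tetrahedron over the face. The remaining
  points lie in finitely many planes.
\<close>

theorem volume_le: "measure lebesgue P \<le> (\<Sum>i\<in>I. (A i \<bullet> cross3 (B i) (C i)) / 6)"
proof -
  let ?T = "\<lambda>i. convex hull {0, A i, B i, C i}"
  let ?W = "\<Union>i\<in>I. walls i"
  have W: "negligible ?W" using fin negligible_walls by (intro negligible_Union) auto
  have "P \<subseteq> (\<Union>i\<in>I. ?T i) \<union> ?W"
  proof
    fix v assume v: "v \<in> P"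
    show "v \<in> (\<Union>i\<in>I. ?T i) \<union> ?W"
    proof (cases "v \<in> ?W \<or> v = 0")
      case True
      then show ?thesis using index_nonempty by (auto intro: hull_inc)
    next
      case False
      then obtain i where i: "i \<in> I" "v \<in> cone i" using cones_cover by blast
      then have vo: "v \<in> open_cone i" using False cone_diff_walls[of i] by blast
      obtain s where s: "s > 0" "s *\<^sub>R v \<in> face i"
        using tri_cone_scale_to_triangle[OF orient[OF i(1)] i(2)] False by blast
      have v_eq: "v = (1 / s) *\<^sub>R (s *\<^sub>R v)" using s by simp
      have "1 / s \<le> 1"
      proof (rule ccontr)
        assume "\<not> 1 / s \<le> 1"
        then have "(1 / s) *\<^sub>R (s *\<^sub>R v) \<notin> P"
          using i s vo by (intro beyond_face_interior) (auto simp: open_cone_scaleR)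
        then show False using v s by simp
      qed
      moreover have "0 \<in> ?T i" by (simp add: hull_inc)
      moreover have "s *\<^sub>R v \<in> ?T i" using s(2) hull_mono[of "{A i, B i, C i}" "{0, A i, B i, C i}"] by blast
      ultimately have "(1 - 1 / s) *\<^sub>R 0 + (1 / s) *\<^sub>R (s *\<^sub>R v) \<in> ?T i"
        using s(1) by (intro convexD[OF convex_convex_hull]) auto
      then show ?thesis using i(1) s(1) by auto
    qed
  qed
  moreover have T: "?T i \<in> lmeasurable" for i
    by (intro lmeasurable_compact finite_imp_compact_convex_hull) auto
  moreover have TW: "(\<Union>i\<in>I. ?T i) \<in> lmeasurable" "?W \<in> lmeasurable"
    using T fin negligible_imp_measurable[OF W] by (auto intro: fmeasurable.finite_UN)
  ultimately have "measure lebesgue P \<le> measure lebesgue ((\<Union>i\<in>I. ?T i) \<union> ?W)"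
    using lmeasurable_compact[OF comp]
    by (intro measure_mono_fmeasurable fmeasurable.Un) (auto intro: fmeasurableD)
  also have "\<dots> \<le> measure lebesgue (\<Union>i\<in>I. ?T i) + measure lebesgue ?W"
    using TW by (intro measure_Un_le fmeasurableD)
  also have "measure lebesgue ?W = 0" using W by (rule negligible_imp_measure0)
  also have "measure lebesgue (\<Union>i\<in>I. ?T i) \<le> (\<Sum>i\<in>I. measure lebesgue (?T i))"
    using T fin by (intro measure_UNION_le) (auto intro: fmeasurableD)
  also have "\<dots> = (\<Sum>i\<in>I. (A i \<bullet> cross3 (B i) (C i)) / 6)"
    by (simp add: measure_tetrahedron_at_origin orient)
  finally show ?thesis by simp
qed

end

section \<open>The volume bound\<close>

text \<open>
  Exchanging \<open>A\<close> and \<open>B\<close> reverses the sign of the triple product and preserves the edge \<open>AB\<close>, so the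
  orientation can be chosen without giving up the edge distinguished by
  \<open>max_central_angle_edge_length\<close>.
\<close>

lemma face_vertices:
  fixes T :: "(real ^ 3) set"
  assumes simplex: "2 simplex T" and sph: "{x. x extreme_point_of T} \<subseteq> sphere 0 1"
    and edge: "max_central_angle_edge_length T c" and area: "0 < spherical_area (central_projection T)"
  obtains A B C where "T = convex hull {A, B, C}" "norm A = 1" "norm B = 1" "norm C = 1"
    "0 < A \<bullet> cross3 B C" "c = vangle A B"
proof -
  obtain S where S: "\<not> affine_dependent S" "int (card S) = 3" "T = convex hull S"
    using simplex by (auto simp: simplex_def)
  have "{x. x extreme_point_of T} = S"
    unfolding S(3) using extreme_point_of_convex_hull_affine_independent[OF S(1)] by blast
  moreover obtain A B C where "{x. x extreme_point_of T} = {A, B, C}" and c: "c = vangle A B"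
    using edge by (auto simp: max_central_angle_edge_length_def)
  ultimately have S_eq: "S = {A, B, C}" and ext: "{x. x extreme_point_of T} = {A, B, C}" by auto
  have T: "T = convex hull {A, B, C}" using S(3) S_eq by simp
  have u: "norm A = 1" "norm B = 1" "norm C = 1" using sph unfolding ext by auto
  have "A \<noteq> B" "A \<noteq> C" "B \<noteq> C" using S(2) unfolding S_eq by (auto simp: card_insert_if split: if_splits)
  then have "A \<bullet> cross3 B C \<noteq> 0" using spherical_area_coplanar[OF u] area unfolding T by auto
  then consider "0 < A \<bullet> cross3 B C" | "0 < B \<bullet> cross3 A C"
    unfolding triple_product_swap[of B A C] by linarith
  then show thesis
  proof cases
    case 1 then show thesis using that T u c by blast
  next
    case 2
    moreover have "T = convex hull {B, A, C}" using T by (simp add: insert_commute)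
    moreover have "c = vangle B A" using c by (simp add: vangle_def inner_commute mult.commute)
    ultimately show thesis using that u by blast
  qed
qed

lemma inscribed_tetrahedron_volume_le_vol:
  fixes A B C :: "real ^ 3"
  assumes u: "norm A = 1" "norm B = 1" "norm C = 1" and D: "0 < A \<bullet> cross3 B C"
  defines "\<tau> \<equiv> spherical_area (central_projection (convex hull {A, B, C}))"
  assumes \<tau>: "0 < \<tau>" "\<tau> < pi"
  shows "(A \<bullet> cross3 B C) / 6 \<le> vol \<tau> (vangle A B)"
proof -
  define c where "c = vangle A B"
  have "(norm (cross3 A B))\<^sup>2 + (A \<bullet> B)\<^sup>2 = 1" using norm_cross_dot[of A B] u by simp
  moreover have "cross3 A B \<noteq> 0" using D triple_product_rotate(2)[of C A B] by (metis inner_zero_right less_irrefl)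
  then have "(norm (cross3 A B))\<^sup>2 > 0" by simp
  ultimately have "(A \<bullet> B)\<^sup>2 < 1" by linarith
  then have "\<bar>A \<bullet> B\<bar> < 1" by (simp only: abs_square_less_1)
  then have lt: "- 1 < A \<bullet> B" "A \<bullet> B < 1" by linarith+
  have c: "0 < c" "c < pi" "cos c = A \<bullet> B"
    using arccos_lt_bounded[OF lt] lt u by (simp_all add: c_def vangle_def)
  have "\<tau> = 3 * measure lebesgue (cball 0 1 \<inter> {v. 0 \<le> cross3 B C \<bullet> v}
                    \<inter> {v. 0 \<le> cross3 C A \<bullet> v} \<inter> {v. 0 \<le> cross3 A B \<bullet> v})"
    unfolding \<tau>_def spherical_area_triangle[OF D] tri_cone_def by (simp only: Int_assoc)
  then have "(A \<bullet> cross3 B C) * cos (\<tau> / 2) = (1 + cos c + A \<bullet> C + B \<bullet> C) * sin (\<tau> / 2)"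
    using tan_half_solid_angle[OF u D] c(3) by simp
  then have "(A \<bullet> cross3 B C) / 6 \<le> vol (2 * (\<tau> / 2)) c"
    using c \<tau> D triple_product_squared_unit[OF u]
    by (intro triple_product_le_isosceles[of c "\<tau> / 2" _ "A \<bullet> C" "B \<bullet> C"]) auto
  then show ?thesis by (simp add: c_def)
qed

theorem theorem1:
  fixes P :: "(real ^ 3) set" and F :: "nat \<Rightarrow> (real ^ 3) set"
    and f f' :: nat and \<tau> c :: "nat \<Rightarrow> real" and \<phi> :: "real \<Rightarrow> real" and c' cstar :: real
  assumes "triangular_polyhedron P f F"
    and "inscribed_in_unit_sphere f F"
    and "star_shaped_wrt 0 P"
    and "\<And>i. i \<in> {1..f} \<Longrightarrow> max_central_angle_edge_length (F i) (c i)"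
    and "\<And>i. i \<in> {1..f} \<Longrightarrow> \<tau> i = spherical_area (central_projection (F i))"
    and "separating_function \<phi>"
    and "\<And>i. i \<in> {1..f} \<Longrightarrow> 0 < \<tau> i \<and> \<tau> i < pi / 2"
    and "f' \<le> f"
    and "\<And>i. i \<in> {1..f'} \<Longrightarrow>
           0 < \<tau> i \<and> \<tau> i \<le> c i \<and> c i \<le> min (\<phi> (\<tau> i)) (2 * arcsin (sqrt (2 / 3)))"
    and "\<And>j. j \<in> {f'+1..f} \<Longrightarrow>
           0 < \<phi> (\<tau> j) \<and> \<phi> (\<tau> j) \<le> c j \<and> c j \<le> 2 * arcsin (sqrt (2 / 3))"
    and "c' = 1 / real f' * (\<Sum>i=1..f'. c i)"
    and "cstar = 1 / (real f - real f') * (\<Sum>i=f'+1..f. \<phi> (\<tau> i))"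
  shows "measure lebesgue P \<le>
    real f / 6 * sin ((real f' * c' + (real f - real f') * cstar) / real f) *
      ((cos ((4 * pi - real f' * c' - (real f - real f') * cstar) / (2 * real f))
         - cos (2 * pi / real f) * cos ((real f' * c' + (real f - real f') * cstar) / (2 * real f)))
       / (1 - cos (2 * pi / real f)
              * cos ((real f' * c' + (real f - real f') * cstar) / (2 * real f))))"
proof -
  note poly = assms(1)[unfolded triangular_polyhedron_def]
  note \<phi> = assms(6)
  let ?I = "{1..f}"
  have \<tau>: "0 < \<tau> i" "\<tau> i < pi / 2" if "i \<in> ?I" for i using assms(7)[OF that] by auto
  have "\<forall>i\<in>?I. \<exists>V. case V of (A, B, C) \<Rightarrow> F i = convex hull {A, B, C} \<and> norm A = 1 \<and> norm B = 1 \<and> norm C = 1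
      \<and> 0 < A \<bullet> cross3 B C \<and> c i = vangle A B"
  proof
    fix i assume i: "i \<in> ?I"
    obtain A B C where "F i = convex hull {A, B, C}" "norm A = 1" "norm B = 1" "norm C = 1"
      "0 < A \<bullet> cross3 B C" "c i = vangle A B"
    proof (rule face_vertices)
      show "2 simplex F i" using poly i by blast
      show "{x. x extreme_point_of F i} \<subseteq> sphere 0 1"
        using assms(2) i unfolding inscribed_in_unit_sphere_def by blast
      show "max_central_angle_edge_length (F i) (c i)" by (rule assms(4)[OF i])
      show "0 < spherical_area (central_projection (F i))" using \<tau>(1)[OF i] assms(5)[OF i] by simp
    qed
    then show "\<exists>V. case V of (A, B, C) \<Rightarrow> F i = convex hull {A, B, C} \<and> norm A = 1 \<and> norm B = 1 \<and> norm C = 1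
        \<and> 0 < A \<bullet> cross3 B C \<and> c i = vangle A B"
      by (intro exI[of _ "(A, B, C)"]) simp
  qed
  from bchoice[OF this] obtain V where V: "\<forall>i\<in>?I. case V i of (A, B, C) \<Rightarrow> F i = convex hull {A, B, C} \<and>
      norm A = 1 \<and> norm B = 1 \<and> norm C = 1 \<and> 0 < A \<bullet> cross3 B C \<and> c i = vangle A B"
    by (rule exE)
  define A B C where "A = (\<lambda>i. fst (V i))" and "B = (\<lambda>i. fst (snd (V i)))" and "C = (\<lambda>i. snd (snd (V i)))"
  have vert: "F i = convex hull {A i, B i, C i}" "norm (A i) = 1" "norm (B i) = 1" "norm (C i) = 1"
    "0 < A i \<bullet> cross3 (B i) (C i)" "c i = vangle (A i) (B i)" if "i \<in> ?I" for i
    using bspec[OF V that] by (simp_all add: A_def B_def C_def split: prod.splits)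
  have cong: "inj_on (\<lambda>i. convex hull {A i, B i, C i}) ?I \<longleftrightarrow> inj_on F ?I"
    "(\<lambda>i. convex hull {A i, B i, C i}) ` ?I = F ` ?I"
    "(\<Union>i\<in>?I. convex hull {A i, B i, C i}) = (\<Union>i\<in>?I. F i)"
    using vert(1) by (auto intro!: inj_on_cong image_cong SUP_cong)
  interpret star_polyhedron P ?I A B C
  proof
    show "2 simplex convex hull {A i, B i, C i}" if "i \<in> ?I" for i
      using poly that unfolding vert(1)[OF that, symmetric] by blast
  qed (use poly assms(3) vert(5) cong in auto)

  have \<tau>_eq: "\<tau> i = spherical_area (central_projection (convex hull {A i, B i, C i}))" if "i \<in> ?I" for i
    using assms(5)[OF that] vert(1)[OF that] by simp
  have sum_\<tau>: "(\<Sum>i\<in>?I. \<tau> i) = 4 * pi"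
    using sum_spherical_area \<tau>_eq by simp
  \<comment> \<open>The edge lengths of the concave comparison: those above the graph of \<open>\<phi>\<close> are lowered to it.\<close>
  define e where "e = (\<lambda>i. if i \<le> f' then c i else \<phi> (\<tau> i))"
  have e: "vol (\<tau> i) (c i) \<le> vol (\<tau> i) (e i) \<and> \<tau> i \<le> e i \<and> e i \<le> min (\<phi> (\<tau> i)) c_max"
    if i: "i \<in> ?I" for i
  proof (cases "i \<le> f'")
    case True
    then show ?thesis using assms(9)[of i] i by (simp add: e_def c_max_def)
  next
    case False
    then have j: "0 < \<phi> (\<tau> i)" "\<phi> (\<tau> i) \<le> c i" "c i \<le> c_max"
      using assms(10)[of i] i by (auto simp: c_max_def)
    have "0 \<le> edge_slope (\<tau> i / 2) (\<phi> (\<tau> i) / 2)"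
      using j \<tau>[OF i] by (intro separating_function_edge_slope_nonneg[OF \<phi>]) auto
    then have "vol (\<tau> i) (c i) \<le> vol (\<tau> i) (\<phi> (\<tau> i))"
      using j \<tau>[OF i] c_max_bounds by (intro vol_antimono_edge) (auto simp: edge_slope_def)
    moreover have "\<tau> i < \<phi> (\<tau> i)" using j \<tau>[OF i] by (intro separating_function_above_diagonal[OF \<phi>])
    ultimately show ?thesis using False j by (simp add: e_def)
  qed
  define M where "M = (\<Sum>i\<in>?I. e i)"
  have "?I = {1..f'} \<union> {f'+1..f}" "{1..f'} \<inter> {f'+1..f} = {}" using assms(8) by auto
  then have "M = (\<Sum>i=1..f'. e i) + (\<Sum>i=f'+1..f. e i)"
    unfolding M_def by (simp add: sum.union_disjoint)
  also have "(\<Sum>i=1..f'. e i) = (\<Sum>i=1..f'. c i)" by (intro sum.cong) (auto simp: e_def)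
  also have "\<dots> = real f' * c'" by (simp add: assms(11))
  also have "(\<Sum>i=f'+1..f. e i) = (\<Sum>i=f'+1..f. \<phi> (\<tau> i))" by (intro sum.cong) (auto simp: e_def)
  also have "\<dots> = (real f - real f') * cstar" using assms(8) by (simp add: assms(12))
  finally have M: "real f' * c' + (real f - real f') * cstar = M" by simp
  have "measure lebesgue P \<le> (\<Sum>i\<in>?I. (A i \<bullet> cross3 (B i) (C i)) / 6)" by (rule volume_le)
  also have "\<dots> \<le> (\<Sum>i\<in>?I. vol (\<tau> i) (e i))"
  proof (rule sum_mono)
    fix i assume i: "i \<in> ?I"
    have "(A i \<bullet> cross3 (B i) (C i)) / 6 \<le> vol (\<tau> i) (c i)"
      using inscribed_tetrahedron_volume_le_vol[OF vert(2-5)[OF i]] \<tau>[OF i] \<tau>_eq[OF i] vert(6)[OF i] by simp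
    then show "(A i \<bullet> cross3 (B i) (C i)) / 6 \<le> vol (\<tau> i) (e i)" using e[OF i] by linarith
  qed
  also have "\<dots> \<le> card ?I * vol ((\<Sum>i\<in>?I. \<tau> i) / card ?I) ((\<Sum>i\<in>?I. e i) / card ?I)"
    using e \<tau> by (intro sum_vol_le_vol_mean[OF \<phi>] fin index_nonempty) auto
  also have "\<dots> = real f * vol (4 * pi / real f) (M / real f)" unfolding sum_\<tau> M_def by simp
  finally have le: "measure lebesgue P \<le> real f * vol (4 * pi / real f) (M / real f)" .
  have "f > 0" using index_nonempty by auto
  then have arg: "(4 * pi / real f - M / real f) / 2 = (4 * pi - M) / (2 * real f)"
    "4 * pi / real f / 2 = 2 * pi / real f" "M / real f / 2 = M / (2 * real f)"
    by (simp_all add: field_simps)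
  have M': "4 * pi - real f' * c' - (real f - real f') * cstar = 4 * pi - M" unfolding M[symmetric] by simp
  show ?thesis
    using le unfolding vol_def arg M M' by (simp add: mult.commute[of "cos (M / (2 * real f))"])
qed

end
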